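(* Let $\mathcal{H}$ be a real or complex Hilbert space and let $S$ be a densely defined symmetric operator on $\mathcal{H}$ with lower bound $\mathfrak{m}(S)>0$, and let $S_F$ be its Friedrichs extension. Then $S$ admits self-adjoint extensions other than $S_F$ having the same lower bound $\mathfrak{m}(S)$ if and only if $$\mathrm{ran}\big((S_F-\mathfrak{m}(S)\mathbb{1})^{1/2}\big)\cap\ker S^*\neq\{0\}.$$
   Context: For a symmetric operator $R$, $\mathfrak{m}(R)=\inf_{0\neq f\in\mathcal{D}(R)}\langle f,Rf\rangle/\|f\|^2$ is its largest lower bound; the lower bound of a self-adjoint extension $\widetilde S$ is $\mathfrak{m}(\widetilde S)$. The Friedrichs extension $S_F$ is the unique self-adjoint extension of $S$ whose operator domain is contained in the form domain of $S$ (the closure of $\mathcal{D}(S)$ in the norm $(\langle f,Sf\rangle+\|f\|^2)^{1/2}$); it satisfies $\mathfrak{m}(S_F)=\mathfrak{m}(S)$. $(S_F-\mathfrak{m}(S)\mathbb{1})^{1/2}$ is the nonnegative square root defined by functional calculus. *)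

theory Defs
  imports "HOL-Analysis.Analysis"
begin

text \<open>
  Hilbert spaces.  A real Hilbert space is a type of class real_inner + complete_space.
  A complex Hilbert space is encoded by its realification: a real Hilbert space together
  with an orthogonal complex structure J (multiplication by i), i.e. a real-linear map with
  J (J x) = -x and inner (J x) (J y) = inner x y; the complex inner product is
  inner x y + i * inner (J x) y, whose real part is the real inner product.
  Complex-linear operators are exactly those whose graph is invariant under J x J.
  The flag cplx selects the scalar field (False: real, True: complex).

  (Possibly unbounded) linear operators are represented by their graphs.
\<close>

definition orth_complex_structure :: "('a::real_inner \<Rightarrow> 'a) \<Rightarrow> bool" where
  "orth_complex_structure J \<longleftrightarrow>
     linear J \<and> (\<forall>x. J (J x) = - x) \<and> (\<forall>x y. inner (J x) (J y) = inner x y)"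

definition admissible :: "bool \<Rightarrow> ('a::real_inner \<Rightarrow> 'a) \<Rightarrow> ('a \<times> 'a) set \<Rightarrow> bool" where
  "admissible cplx J G \<longleftrightarrow> subspace G \<and> (cplx \<longrightarrow> (\<forall>(x, y)\<in>G. (J x, J y) \<in> G))"

definition lin_op :: "bool \<Rightarrow> ('a::real_inner \<Rightarrow> 'a) \<Rightarrow> ('a \<times> 'a) set \<Rightarrow> bool" where
  "lin_op cplx J G \<longleftrightarrow> admissible cplx J G \<and> (\<forall>x y z. (x, y) \<in> G \<longrightarrow> (x, z) \<in> G \<longrightarrow> y = z)"

definition densely_defined :: "('a::real_inner \<times> 'a) set \<Rightarrow> bool" where
  "densely_defined G \<longleftrightarrow> closure (Domain G) = UNIV"

definition symmetric_op :: "('a::real_inner \<times> 'a) set \<Rightarrow> bool" where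
  "symmetric_op G \<longleftrightarrow> (\<forall>(f, Sf)\<in>G. \<forall>(g, Sg)\<in>G. inner f Sg = inner Sf g)"

definition adjoint_op :: "('a::real_inner \<times> 'a) set \<Rightarrow> ('a \<times> 'a) set" where
  "adjoint_op G = {(g, h). \<forall>(f, Sf)\<in>G. inner Sf g = inner f h}"

definition self_adjoint :: "bool \<Rightarrow> ('a::real_inner \<Rightarrow> 'a) \<Rightarrow> ('a \<times> 'a) set \<Rightarrow> bool" where
  "self_adjoint cplx J G \<longleftrightarrow> lin_op cplx J G \<and> densely_defined G \<and> adjoint_op G = G"

definition ker_op :: "('a::real_vector \<times> 'a) set \<Rightarrow> 'a set" where
  "ker_op G = {x. (x, 0) \<in> G}"

definition lower_bound :: "('a::real_inner \<times> 'a) set \<Rightarrow> ereal" where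
  "lower_bound G = (INF p\<in>{p\<in>G. fst p \<noteq> 0}. ereal (inner (fst p) (snd p) / (norm (fst p))\<^sup>2))"

text \<open>Form domain: closure of D(S) in the norm (<f,Sf> + ||f||^2)^(1/2), realised inside H:
  the limits in H of sequences in D(S) that are Cauchy for that norm.\<close>
definition form_domain :: "('a::real_inner \<times> 'a) set \<Rightarrow> 'a set" where
  "form_domain G = {h. \<exists>p. (\<forall>n. p n \<in> G) \<and> ((\<lambda>n. fst (p n)) \<longlonglongrightarrow> h) \<and>
      (\<forall>e>0. \<exists>N. \<forall>m\<ge>N. \<forall>n\<ge>N.
          inner (fst (p m) - fst (p n)) (snd (p m) - snd (p n)) + (norm (fst (p m) - fst (p n)))\<^sup>2 < e)}"

definition friedrichs :: "bool \<Rightarrow> ('a::real_inner \<Rightarrow> 'a) \<Rightarrow> ('a \<times> 'a) set \<Rightarrow> ('a \<times> 'a) set" where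
  "friedrichs cplx J S = (THE T. self_adjoint cplx J T \<and> S \<subseteq> T \<and> Domain T \<subseteq> form_domain S)"

definition shift_op :: "('a::real_vector \<times> 'a) set \<Rightarrow> real \<Rightarrow> ('a \<times> 'a) set" where
  "shift_op T c = {(x, y - c *\<^sub>R x) | x y. (x, y) \<in> T}"

definition nonneg_op :: "('a::real_inner \<times> 'a) set \<Rightarrow> bool" where
  "nonneg_op G \<longleftrightarrow> (\<forall>(f, g)\<in>G. 0 \<le> inner f g)"

text \<open>Nonnegative square root of a nonnegative self-adjoint operator: the unique nonnegative
  self-adjoint R with R R = T (this is the operator given by the functional calculus).\<close>
definition op_sqrt :: "bool \<Rightarrow> ('a::real_inner \<Rightarrow> 'a) \<Rightarrow> ('a \<times> 'a) set \<Rightarrow> ('a \<times> 'a) set" where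
  "op_sqrt cplx J T = (THE R. self_adjoint cplx J R \<and> nonneg_op R \<and> R O R = T)"

end

theory Submission
  imports Defs
begin

text \<open>
  Write \<open>m\<close> for the lower bound of \<open>S\<close>. By the Douglas range argument, \<open>u\<close> lies in the range of
  the square root of \<open>S\<^sub>F - m\<close> iff \<open>\<langle>f, u\<rangle>\<^sup>2 \<le> c * \<langle>f, (S - m) f\<rangle>\<close> on the domain of \<open>S\<close>, which is
  a form core. If \<open>T\<close> is another extension with lower bound \<open>m\<close>, then \<open>T\<close> and \<open>S\<^sub>F\<close> are both onto and
  differ in some preimages \<open>g\<close> and \<open>f\<close> of one vector \<open>x\<close>; \<open>u = g - f\<close> is in the kernel of the
  adjoint, and the bound follows from \<open>m * u = (x - m * f) - (x - m * g)\<close> and the Cauchy-Schwarz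
  inequalities for the forms of \<open>S\<^sub>F - m\<close> and \<open>T - m\<close>. Conversely, for such \<open>u\<close> the inverse of a
  suitable \<open>T\<close> is the inverse of \<open>S\<^sub>F\<close> plus a small multiple of the projection onto the span
  of \<open>u\<close>.
\<close>

section \<open>Forms and the Riesz representation theorem\<close>

text \<open>No spectral measure appears. The square root of A = S_F - m is assembled from two
  bounded operators, the roots of the resolvent at -1 and of its complement, each a limit of
  polynomials. Such limits commute with whatever commutes with the resolvent, in particular with J
  and with a bounded version of any competing root; uniqueness of the root rests on this. All inner
  products are real, and complex linearity enters only as invariance of graphs under J. In the
  complex case the perturbation must therefore involve u and J u together. The obstacle in the
  converse is that the new lower bound has to be m itself. The form of S_F - m has infimum 0 on unit
  vectors, so there is no slack to absorb a perturbation, however small. The range condition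
  supplies what is missing: it bounds \<open>(inner f u)^2\<close> by that form, and the size of the
  multiple is found by completing squares.\<close>

lemma quadratic_nonneg_imp:
  fixes b d e :: real
  assumes "b \<ge> 0" and nonneg: "\<And>t. 0 \<le> d + 2 * t * e + t\<^sup>2 * b"
  shows "e\<^sup>2 \<le> d * b"
proof (cases "b = 0")
  case True
  have "e = 0"
  proof (rule ccontr)
    assume "e \<noteq> 0"
    \<comment> \<open>With \<open>b = 0\<close> the expression is affine in t, and this t gives it
      the value -1.\<close>
    then show False
      using nonneg[of "- (d + 1) / (2 * e)"] True by (simp add: field_simps)
  qed
  then show ?thesis using True by simp
next
  case False
  then have "b > 0" using assms(1) by simp
  then show ?thesis
    using nonneg[of "- e / b"] by (simp add: field_simps power2_eq_square)
qed

lemma bilinear_quadratic: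
  assumes "bilinear b" "b y x = b x y"
  shows "b (x + t *\<^sub>R y) (x + t *\<^sub>R y) = b x x + 2 * t * b x y + t\<^sup>2 * (b y y :: real)"
  using assms
  by (simp add: bilinear_ladd bilinear_radd bilinear_lmul bilinear_rmul
      algebra_simps power2_eq_square)

text \<open>Symmetry and nonnegativity are asked on G alone: the form of an operator is bilinear on
  the whole product space, but has these two properties only along the graph.\<close>

lemma bilinear_Cauchy_Schwarz:
  fixes b :: "'b::real_vector \<Rightarrow> 'b \<Rightarrow> real"
  assumes G: "subspace G" and b: "bilinear b"
    and sym: "\<And>p q. p \<in> G \<Longrightarrow> q \<in> G \<Longrightarrow> b p q = b q p"
    and nonneg: "\<And>p. p \<in> G \<Longrightarrow> 0 \<le> b p p"
    and "p \<in> G" "q \<in> G"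
  shows "(b p q)\<^sup>2 \<le> b p p * b q q"
proof (rule quadratic_nonneg_imp)
  fix t :: real
  have "p + t *\<^sub>R q \<in> G"
    using G assms(5,6) by (simp add: subspace_add subspace_scale)
  then show "0 \<le> b p p + 2 * t * b p q + t\<^sup>2 * b q q"
    using nonneg bilinear_quadratic[OF b, of q p t] sym[OF assms(5,6)] by metis
qed (use nonneg assms in auto)

lemma bilinear_parallelogram:
  assumes "bilinear b"
  shows "b (x + y) (x + y) + b (x - y) (x - y) = 2 * b x x + 2 * (b y y :: real)"
  using assms by (simp add: bilinear_ladd bilinear_radd bilinear_lsub bilinear_rsub)

text \<open>The Riesz representation theorem in a space that need not be complete: the sequence
  minimises \<open>b p p - 2 * l p\<close>.\<close>

lemma Riesz_approximating_sequence:
  fixes b :: "'b::real_vector \<Rightarrow> 'b \<Rightarrow> real"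
  assumes G: "subspace G" and b: "bilinear b"
    and sym: "\<And>p q. p \<in> G \<Longrightarrow> q \<in> G \<Longrightarrow> b p q = b q p"
    and nonneg: "\<And>p. p \<in> G \<Longrightarrow> 0 \<le> b p p"
    and l: "linear l" and bound: "\<And>p. p \<in> G \<Longrightarrow> (l p)\<^sup>2 \<le> c * b p p"
  obtains p where "\<And>n. p n \<in> G"
    and "\<And>e. e > 0 \<Longrightarrow> \<exists>N. \<forall>m\<ge>N. \<forall>n\<ge>N. b (p m - p n) (p m - p n) < e"
    and "\<And>q. q \<in> G \<Longrightarrow> (\<lambda>n. b (p n) q) \<longlonglongrightarrow> l q"
proof -
  define F where "F p = b p p - 2 * l p" for p
  define M where "M = Inf (F ` G)"
  \<comment> \<open>The inequality between arithmetic and geometric mean turns the bound on l into 2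
    |l p| \<le> |c| + b p p.\<close>
  have "- \<bar>c\<bar> \<le> F p" if "p \<in> G" for p
  proof -
    have "(2 * l p)\<^sup>2 \<le> 4 * (\<bar>c\<bar> * b p p)"
      using bound[OF that] mult_right_mono[OF abs_ge_self[of c] nonneg[OF that]]
      by (simp add: power_mult_distrib)
    also have "\<dots> \<le> (\<bar>c\<bar> + b p p)\<^sup>2"
      using zero_le_power2[of "\<bar>c\<bar> - b p p"] by (simp add: power2_eq_square algebra_simps)
    finally have "\<bar>2 * l p\<bar> \<le> \<bar>\<bar>c\<bar> + b p p\<bar>"
      by (simp only: abs_le_square_iff)
    then show ?thesis using nonneg[OF that] by (simp add: F_def)
  qed
  then have bdd: "bdd_below (F ` G)"
    by (intro bdd_belowI2)
  have M: "M \<le> F p" if "p \<in> G" for p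
    unfolding M_def using bdd that by (simp add: cInf_lower)
  have "\<exists>p\<in>G. F p < M + 1 / real (Suc n)" for n
  proof -
    have "Inf (F ` G) < M + 1 / real (Suc n)" by (simp add: M_def)
    moreover have "F ` G \<noteq> {}" using subspace_0[OF G] by auto
    ultimately show ?thesis using cInf_lessD[of "F ` G"] by auto
  qed
  then obtain p where p: "\<And>n. p n \<in> G" "\<And>n. F (p n) < M + 1 / real (Suc n)" by metis
  have lim: "(\<lambda>n. 1 / real (Suc n)) \<longlonglongrightarrow> 0"
    using LIMSEQ_inverse_real_of_nat by (simp add: inverse_eq_divide)
  have Cau: "\<exists>N. \<forall>m\<ge>N. \<forall>n\<ge>N. b (p m - p n) (p m - p n) < e" if "e > 0" for e
  proof -
    obtain N where N: "\<forall>n\<ge>N. 1 / real (Suc n) < e / 4"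
      using order_tendstoD(2)[OF lim, of "e / 4"] \<open>e > 0\<close> unfolding eventually_sequentially by auto
    have "b (p m - p n) (p m - p n) < e" if "m \<ge> N" "n \<ge> N" for m n
    proof -
      \<comment> \<open>At the midpoint the linear part of F cancels in the parallelogram law. What
        remains is twice two almost minimal values minus four times a value of at least M; the gaps
        of e/4 add up to e.\<close>
      define h where "h = (1/2::real) *\<^sub>R (p m + p n)"
      have h: "h \<in> G" unfolding h_def using p(1) G by (simp add: subspace_add subspace_scale)
      have "4 * F ((1/2) *\<^sub>R z) = b z z - 4 * l z" for z
        unfolding F_def using l b
        by (simp add: linear_cmul bilinear_lmul bilinear_rmul)
      then have "4 * F h = b (p m + p n) (p m + p n) - 4 * l (p m) - 4 * l (p n)"
        using l unfolding h_def by (metis (no_types) linear_add diff_diff_eq distrib_left)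
      then have "b (p m - p n) (p m - p n) = 2 * F (p m) + 2 * F (p n) - 4 * F h"
        using bilinear_parallelogram[OF b, of "p m" "p n"] by (simp add: F_def)
      moreover have "F (p m) < M + e / 4" "F (p n) < M + e / 4"
        using p(2)[of m] p(2)[of n] N that by (smt (verit))+
      ultimately show ?thesis using M[OF h] by linarith
    qed
    then show ?thesis by blast
  qed
  have "(\<lambda>n. b (p n) q) \<longlonglongrightarrow> l q" if q: "q \<in> G" for q
  proof -
    \<comment> \<open>Along the line p n + t q, F is a quadratic in t that stays above M, so the gap
      1/(n+1) bounds the square of half its derivative at t = 0.\<close>
    have *: "(b (p n) q - l q)\<^sup>2 \<le> 1 / real (Suc n) * b q q" for n
    proof (rule quadratic_nonneg_imp)
      fix t :: real
      have "p n + t *\<^sub>R q \<in> G"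
        using G q p(1) by (simp add: subspace_add subspace_scale)
      from M[OF this] have "M \<le> F (p n) + 2 * t * (b (p n) q - l q) + t\<^sup>2 * b q q"
        unfolding F_def using bilinear_quadratic[OF b, of q "p n" t] sym[OF p(1) q] l
        by (simp add: linear_cmul linear_add algebra_simps)
      then show "0 \<le> 1 / real (Suc n) + 2 * t * (b (p n) q - l q) + t\<^sup>2 * b q q"
        using p(2)[of n] by linarith
    qed (use nonneg q in auto)
    have "(\<lambda>n. (b (p n) q - l q)\<^sup>2) \<longlonglongrightarrow> 0"
    proof (rule tendsto_sandwich[where f = "\<lambda>_. 0"])
      show "(\<lambda>n. 1 / real (Suc n) * b q q) \<longlonglongrightarrow> 0"
        using tendsto_mult_right[OF lim, of "b q q"] by simp
    qed (use * in auto)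
    from tendsto_real_sqrt[OF this] have "(\<lambda>n. b (p n) q - l q) \<longlonglongrightarrow> 0"
      by (simp add: tendsto_rabs_zero_iff)
    then show ?thesis by (simp add: LIM_zero_iff)
  qed
  with p(1) Cau show thesis by (rule that)
qed

lemma bilinear_inner_fst: "bilinear (\<lambda>p q :: 'a::real_inner \<times> 'c::real_vector. inner (fst p) (fst q))"
  by (auto simp: bilinear_def intro!: linearI simp: inner_add_left inner_add_right)

lemma Cauchy_squareI:
  fixes X :: "nat \<Rightarrow> 'a::real_normed_vector"
  assumes "d > 0"
    and "\<And>e. e > 0 \<Longrightarrow> \<exists>N. \<forall>m\<ge>N. \<forall>n\<ge>N. d * (norm (X m - X n))\<^sup>2 < e"
  shows "Cauchy X"
proof (rule CauchyI)
  fix e :: real assume "e > 0"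
  then obtain N where N: "\<forall>m\<ge>N. \<forall>n\<ge>N. d * (norm (X m - X n))\<^sup>2 < d * e\<^sup>2"
    using assms(2)[of "d * e\<^sup>2"] \<open>d > 0\<close> by auto
  then have "\<forall>m\<ge>N. \<forall>n\<ge>N. (norm (X m - X n))\<^sup>2 < e\<^sup>2" using \<open>d > 0\<close> by simp
  then show "\<exists>N. \<forall>m\<ge>N. \<forall>n\<ge>N. norm (X m - X n) < e"
    using \<open>e > 0\<close> by (meson less_eq_real_def power2_less_imp_less)
qed

text \<open>A bounded functional on a subspace, given by its graph \<open>W\<close>.\<close>

lemma Riesz_representation_graph:
  fixes W :: "('a::{real_inner, complete_space} \<times> real) set"
  assumes "subspace W" and "\<And>w r. (w, r) \<in> W \<Longrightarrow> r\<^sup>2 \<le> c * (norm w)\<^sup>2"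
  obtains g where "\<And>w r. (w, r) \<in> W \<Longrightarrow> inner w g = r"
proof -
  obtain p where p: "\<And>n. p n \<in> W"
    "\<And>e. e > 0 \<Longrightarrow> \<exists>N. \<forall>m\<ge>N. \<forall>n\<ge>N. inner (fst (p m - p n)) (fst (p m - p n)) < e"
    "\<And>q. q \<in> W \<Longrightarrow> (\<lambda>n. inner (fst (p n)) (fst q)) \<longlonglongrightarrow> snd q"
    by (rule Riesz_approximating_sequence[OF assms(1) bilinear_inner_fst, of snd c])
      (use assms(2) in \<open>auto simp: inner_commute linear_snd power2_norm_eq_inner\<close>)
  have "Cauchy (\<lambda>n. fst (p n))"
    by (rule Cauchy_squareI[of 1]) (use p(2) in \<open>simp_all add: power2_norm_eq_inner\<close>)
  then obtain g where "(\<lambda>n. fst (p n)) \<longlonglongrightarrow> g"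
    using Cauchy_convergent convergent_def by blast
  then have "(\<lambda>n. inner (fst (p n)) w) \<longlonglongrightarrow> inner g w" for w
    by (intro tendsto_intros)
  then have "inner w g = r" if "(w, r) \<in> W" for w r
    using p(3)[OF that] LIMSEQ_unique by (metis fst_conv snd_conv inner_commute)
  then show thesis by (rule that)
qed

section \<open>Adjoints\<close>

lemma inner_dense_eq_0:
  fixes z :: "'a::real_inner"
  assumes "closure D = UNIV" "\<And>x. x \<in> D \<Longrightarrow> inner x z = 0"
  shows "z = 0"
proof -
  have "closure D \<subseteq> {x. inner x z = 0}"
    by (rule closure_minimal) (use assms in \<open>auto intro!: closed_Collect_eq continuous_intros\<close>)
  then have "inner z z = 0" using assms(1) by blast
  then show ?thesis by simp
qed

lemma adjoint_op_single_valued: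
  assumes "densely_defined G" "(g, h) \<in> adjoint_op G" "(g, h') \<in> adjoint_op G"
  shows "h = h'"
proof -
  have "h - h' = 0"
    by (rule inner_dense_eq_0[of "Domain G"])
      (use assms in \<open>fastforce simp: densely_defined_def adjoint_op_def inner_diff_right\<close>)+
  then show ?thesis by simp
qed

lemma adjoint_opD: "(g, h) \<in> adjoint_op G \<Longrightarrow> (f, y) \<in> G \<Longrightarrow> inner y g = inner f h"
  by (auto simp: adjoint_op_def)

lemma adjoint_opI: "(\<And>f y. (f, y) \<in> G \<Longrightarrow> inner y g = inner f h) \<Longrightarrow> (g, h) \<in> adjoint_op G"
  by (auto simp: adjoint_op_def)

lemma subspace_adjoint_op: "subspace (adjoint_op G)"
proof (rule subspaceI)
  show "x + y \<in> adjoint_op G" if "x \<in> adjoint_op G" "y \<in> adjoint_op G" for x y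
    using that unfolding adjoint_op_def by (fastforce simp: inner_add_right)
  show "c *\<^sub>R x \<in> adjoint_op G" if "x \<in> adjoint_op G" for c x
    using that unfolding adjoint_op_def by fastforce
qed (simp add: adjoint_op_def zero_prod_def)

lemma adjoint_op_antimono: "G \<subseteq> H \<Longrightarrow> adjoint_op H \<subseteq> adjoint_op G"
  by (auto simp: adjoint_op_def)

lemma orth_complex_structureD:
  assumes "orth_complex_structure J"
  shows "linear J" "J (J x) = - x" "inner (J x) (J y) = inner x y"
    "inner x (J y) = - inner (J x) y" "norm (J x) = norm x"
proof -
  show *: "linear J" "J (J x) = - x" "inner (J x) (J y) = inner x y" for x y
    using assms by (auto simp: orth_complex_structure_def)
  show "inner x (J y) = - inner (J x) y" using *(3)[of x "J y"] *(2)[of y] by simp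
  show "norm (J x) = norm x" using *(3)[of x x] by (simp add: norm_eq_sqrt_inner)
qed

lemma orth_complex_structure_bounded_linear:
  assumes "orth_complex_structure J"
  shows "bounded_linear J"
  using linear_add[OF orth_complex_structureD(1)[OF assms]]
    linear_cmul[OF orth_complex_structureD(1)[OF assms]] orth_complex_structureD(5)[OF assms]
  by (intro bounded_linear_intro[of _ 1]) auto

text \<open>The adjoint is formed with the real inner product. Since J is skew for it and preserves
  G, J can be moved onto the test vectors.\<close>

lemma admissible_adjoint_op:
  assumes "cplx \<longrightarrow> orth_complex_structure J" "admissible cplx J G"
  shows "admissible cplx J (adjoint_op G)"
proof -
  have "(J g, J h) \<in> adjoint_op G" if "cplx" "(g, h) \<in> adjoint_op G" for g h
  proof (rule adjoint_opI)
    fix f y assume "(f, y) \<in> G"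
    then have "(J f, J y) \<in> G" using assms(2) that(1) by (auto simp: admissible_def)
    from adjoint_opD[OF that(2) this] show "inner y (J g) = inner f (J h)"
      using orth_complex_structureD(4) assms(1) that(1) by metis
  qed
  then show ?thesis by (auto simp: admissible_def subspace_adjoint_op)
qed

lemma symmetric_op_iff: "symmetric_op G \<longleftrightarrow> G \<subseteq> adjoint_op G"
  by (fastforce simp: symmetric_op_def adjoint_op_def)

lemma symmetric_opD:
  "symmetric_op G \<Longrightarrow> (f, y) \<in> G \<Longrightarrow> (g, z) \<in> G \<Longrightarrow> inner f z = inner y g"
  by (auto simp: symmetric_op_def)

lemma self_adjointD:
  assumes "self_adjoint cplx J T"
  shows "subspace T" "symmetric_op T" "densely_defined T" "adjoint_op T = T"
    "admissible cplx J T" "lin_op cplx J T"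
    "\<And>x y z. (x, y) \<in> T \<Longrightarrow> (x, z) \<in> T \<Longrightarrow> y = z"
  using assms by (auto simp: self_adjoint_def lin_op_def admissible_def symmetric_op_iff)

section \<open>Criteria for self-adjointness and surjectivity\<close>

lemma self_adjoint_maximal:
  assumes "self_adjoint cplx J T" "self_adjoint cplx J T'" "T \<subseteq> T'"
  shows "T = T'"
  using adjoint_op_antimono[OF assms(3)] self_adjointD(4)[OF assms(1)]
    self_adjointD(4)[OF assms(2)] assms(3) by auto

text \<open>If \<open>(g, h)\<close> is in the adjoint and k is a preimage of h, then g - k is
  orthogonal to the range, which is everything. Both the Friedrichs extension and the new extension
  are proved self-adjoint this way.\<close>

lemma self_adjointI_Range:
  assumes "admissible cplx J T" "densely_defined T" "symmetric_op T" "Range T = UNIV"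
  shows "self_adjoint cplx J T"
proof -
  have sub: "T \<subseteq> adjoint_op T" using assms(3) by (simp add: symmetric_op_iff)
  have "(g, h) \<in> T" if gh: "(g, h) \<in> adjoint_op T" for g h
  proof -
    obtain k where k: "(k, h) \<in> T" using assms(4) by blast
    have "inner x (g - k) = 0" for x
    proof -
      obtain f where "(f, x) \<in> T" using assms(4) by blast
      then show ?thesis
        using adjoint_opD[OF gh] adjoint_opD[of k h] k sub by (fastforce simp: inner_diff_right)
    qed
    from this[of "g - k"] show ?thesis using k by simp
  qed
  then have "adjoint_op T = T" using sub by auto
  then show ?thesis
    using assms adjoint_op_single_valued[OF assms(2)] by (auto simp: self_adjoint_def lin_op_def)
qed

text \<open>The functional sending T f to <f, x> is bounded because d |f| \<le> |T f|. Its
  representing vector lies in the domain of the adjoint, which is T, and is mapped to x.\<close>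

lemma self_adjoint_Range:
  fixes T :: "('a::{real_inner, complete_space} \<times> 'a) set"
  assumes T: "self_adjoint cplx J T" and "d > 0"
    and bound: "\<And>f y. (f, y) \<in> T \<Longrightarrow> d * (norm f)\<^sup>2 \<le> inner f y"
  shows "Range T = UNIV"
proof -
  have "\<exists>g. (g, x) \<in> T" for x
  proof -
    define L where "L p = (snd p, inner (fst p) x)" for p :: "'a \<times> 'a"
    have "linear L" by (rule linearI) (auto simp: L_def inner_add_left)
    then have "subspace (L ` T)" using self_adjointD(1)[OF T] by (rule linear_subspace_image)
    moreover have "r\<^sup>2 \<le> (norm x / d)\<^sup>2 * (norm w)\<^sup>2" if wr: "(w, r) \<in> L ` T" for w r
    proof -
      obtain f where f: "(f, w) \<in> T" "r = inner f x" using wr by (auto simp: L_def)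
      have "d * (norm f)\<^sup>2 \<le> norm f * norm w"
        using bound[OF f(1)] norm_cauchy_schwarz[of f w] by linarith
      then have *: "d * norm f \<le> norm w"
        by (cases "f = 0") (auto simp: power2_eq_square mult.commute)
      have "\<bar>r\<bar> \<le> norm f * norm x" using f(2) Cauchy_Schwarz_ineq2 by blast
      also have "\<dots> \<le> norm w / d * norm x"
        using * \<open>d > 0\<close> by (intro mult_right_mono) (auto simp: field_simps)
      finally have "\<bar>r\<bar> \<le> \<bar>norm x / d * norm w\<bar>" using \<open>d > 0\<close> by (simp add: mult.commute)
      then show ?thesis by (simp only: abs_le_square_iff power_mult_distrib)
    qed
    ultimately obtain g where g: "\<forall>w r. (w, r) \<in> L ` T \<longrightarrow> inner w g = r"
      using Riesz_representation_graph by metis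
    have "(g, x) \<in> adjoint_op T"
      by (rule adjoint_opI, rule g[rule_format]) (force simp: L_def)
    then show ?thesis using self_adjointD(4)[OF T] by auto
  qed
  then show ?thesis by auto
qed

section \<open>The Friedrichs extension\<close>

text \<open>The arguments are points of the graph, not of the domain; this makes the form of an
  unbounded operator bilinear on a whole vector space.\<close>

definition op_form :: "'a::real_inner \<times> 'a \<Rightarrow> 'a \<times> 'a \<Rightarrow> real" where
  "op_form p q = inner (fst p) (snd q)"

lemma bilinear_op_form: "bilinear op_form"
  by (auto simp: bilinear_def op_form_def intro!: linearI simp: inner_add_left inner_add_right)

text \<open>The norm term of the form norm is left out: over a positive lower bound the form alone
  controls it.\<close>

definition form_approx :: "('a::real_inner \<times> 'a) set \<Rightarrow> (nat \<Rightarrow> 'a \<times> 'a) \<Rightarrow> 'a \<Rightarrow> bool" where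
  "form_approx G p f \<longleftrightarrow> (\<forall>n. p n \<in> G) \<and> (\<lambda>n. fst (p n)) \<longlonglongrightarrow> f \<and>
     (\<forall>e>0. \<exists>N. \<forall>m\<ge>N. \<forall>n\<ge>N. op_form (p m - p n) (p m - p n) < e)"

text \<open>The classical description of the Friedrichs extension, the adjoint restricted to the
  form domain. It is the witness for the definite description in \<open>friedrichs\<close>.\<close>

definition friedrichs_restriction :: "('a::real_inner \<times> 'a) set \<Rightarrow> ('a \<times> 'a) set" where
  "friedrichs_restriction G = {(f, y) \<in> adjoint_op G. \<exists>p. form_approx G p f}"

text \<open>\<open>\<mu>\<close> is any positive lower bound, not only the largest; this covers the
  zero space, whose lower bound is infinite.\<close>

locale positive_symmetric =
  fixes cplx :: bool and J :: "'a::{real_inner, complete_space} \<Rightarrow> 'a"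
    and S :: "('a \<times> 'a) set" and \<mu> :: real
  assumes J: "cplx \<longrightarrow> orth_complex_structure J"
    and lin: "lin_op cplx J S"
    and dense: "densely_defined S"
    and symm: "symmetric_op S"
    and \<mu>: "\<mu> > 0"
    and bound: "(f, y) \<in> S \<Longrightarrow> \<mu> * (norm f)\<^sup>2 \<le> inner f y"
begin

abbreviation "SF \<equiv> friedrichs_restriction S"

lemma adm: "admissible cplx J S" and sub: "subspace S"
  using lin by (auto simp: lin_op_def admissible_def)

lemma diff_in: "p \<in> S \<Longrightarrow> q \<in> S \<Longrightarrow> p - q \<in> S"
  using sub by (rule subspace_diff)

lemma form_sym: "p \<in> S \<Longrightarrow> q \<in> S \<Longrightarrow> op_form p q = op_form q p"
  using symmetric_opD[OF symm, of "fst p" "snd p" "fst q" "snd q"]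
  by (simp add: op_form_def inner_commute)

lemma form_ge: "p \<in> S \<Longrightarrow> \<mu> * (norm (fst p))\<^sup>2 \<le> op_form p p"
  using bound[of "fst p" "snd p"] by (simp add: op_form_def)

lemma form_nonneg: "p \<in> S \<Longrightarrow> 0 \<le> op_form p p"
  using form_ge[of p] \<mu> by (meson dual_order.trans less_imp_le mult_nonneg_nonneg zero_le_power2)

lemmas form_Cauchy_Schwarz =
  bilinear_Cauchy_Schwarz[OF sub bilinear_op_form form_sym form_nonneg]

lemma form_add_le:
  "p \<in> S \<Longrightarrow> q \<in> S \<Longrightarrow> op_form (p + q) (p + q) \<le> 2 * op_form p p + 2 * op_form q q"
  using bilinear_parallelogram[OF bilinear_op_form, of p q] form_nonneg[OF diff_in, of p q] by simp

lemma form_approx_const: "p \<in> S \<Longrightarrow> form_approx S (\<lambda>_. p) (fst p)"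
  by (simp add: form_approx_def op_form_def)

lemma form_approx_add:
  assumes "form_approx S p f" "form_approx S q g"
  shows "form_approx S (\<lambda>n. p n + q n) (f + g)"
proof -
  have "\<exists>N. \<forall>m\<ge>N. \<forall>n\<ge>N. op_form (p m + q m - (p n + q n)) (p m + q m - (p n + q n)) < e"
    if "e > 0" for e
  proof -
    have "e / 4 > 0" using that by simp
    obtain N1 where N1: "\<And>m n. m \<ge> N1 \<Longrightarrow> n \<ge> N1 \<Longrightarrow> op_form (p m - p n) (p m - p n) < e / 4"
      using assms(1) \<open>e / 4 > 0\<close> unfolding form_approx_def by meson
    obtain N2 where N2: "\<And>m n. m \<ge> N2 \<Longrightarrow> n \<ge> N2 \<Longrightarrow> op_form (q m - q n) (q m - q n) < e / 4"
      using assms(2) \<open>e / 4 > 0\<close> unfolding form_approx_def by meson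
    have "op_form (p m + q m - (p n + q n)) (p m + q m - (p n + q n)) < e"
      if "m \<ge> max N1 N2" "n \<ge> max N1 N2" for m n
    proof -
      have "p m - p n \<in> S" "q m - q n \<in> S"
        using assms diff_in by (auto simp: form_approx_def)
      from form_add_le[OF this] show ?thesis
        using N1[of m n] N2[of m n] that by (simp add: algebra_simps)
    qed
    then show ?thesis by blast
  qed
  then show ?thesis
    using assms sub by (auto simp: form_approx_def subspace_add intro!: tendsto_intros)
qed

lemma form_approx_scaleR:
  assumes "form_approx S p f"
  shows "form_approx S (\<lambda>n. c *\<^sub>R p n) (c *\<^sub>R f)"
proof -
  have "\<exists>N. \<forall>m\<ge>N. \<forall>n\<ge>N. op_form (c *\<^sub>R p m - c *\<^sub>R p n) (c *\<^sub>R p m - c *\<^sub>R p n) < e"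
    if "e > 0" for e
  proof -
    \<comment> \<open>Dividing by \<open>c^2 + 1\<close> instead of \<open>c^2\<close> includes c =
      0.\<close>
    have c1: "c\<^sup>2 + 1 > 0" by (simp add: add_nonneg_pos)
    have "e / (c\<^sup>2 + 1) > 0" using that c1 by simp
    then obtain N where N: "\<And>m n. m \<ge> N \<Longrightarrow> n \<ge> N
        \<Longrightarrow> op_form (p m - p n) (p m - p n) < e / (c\<^sup>2 + 1)"
      using assms unfolding form_approx_def by meson
    have "op_form (c *\<^sub>R p m - c *\<^sub>R p n) (c *\<^sub>R p m - c *\<^sub>R p n) < e" if "m \<ge> N" "n \<ge> N" for m n
    proof -
      have "op_form (c *\<^sub>R p m - c *\<^sub>R p n) (c *\<^sub>R p m - c *\<^sub>R p n) =
          c\<^sup>2 * op_form (p m - p n) (p m - p n)"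
        unfolding scaleR_diff_right[symmetric]
        by (simp add: op_form_def power2_eq_square)
      also have "\<dots> \<le> c\<^sup>2 * (e / (c\<^sup>2 + 1))"
        using N[OF that] by (intro mult_left_mono) auto
      also have "\<dots> < e"
        using \<open>e > 0\<close> pos_divide_less_eq[OF c1, of "c\<^sup>2 * e" e] by (simp add: algebra_simps)
      finally show ?thesis .
    qed
    then show ?thesis by blast
  qed
  then show ?thesis
    using assms sub by (auto simp: form_approx_def subspace_scale intro!: tendsto_intros)
qed

lemma form_approx_J:
  assumes "cplx" "form_approx S p f"
  shows "form_approx S (\<lambda>n. (J (fst (p n)), J (snd (p n)))) (J f)"
proof -
  have J': "orth_complex_structure J" using J assms(1) by simp
  have "bounded_linear J" using J' by (rule orth_complex_structure_bounded_linear)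
  then have "(\<lambda>n. J (fst (p n))) \<longlonglongrightarrow> J f"
    using assms(2) by (auto simp: form_approx_def intro: bounded_linear.tendsto)
  moreover have "(J (fst (p n)), J (snd (p n))) \<in> S" for n
  proof -
    have "p n \<in> S" using assms(2) by (simp add: form_approx_def)
    then show ?thesis using adm assms(1) by (force simp: admissible_def)
  qed
  moreover have "op_form ((J (fst p), J (snd p)) - (J (fst q), J (snd q)))
      ((J (fst p), J (snd p)) - (J (fst q), J (snd q))) = op_form (p - q) (p - q)"
    for p q :: "'a \<times> 'a"
    using orth_complex_structureD(1,3)[OF J'] by (simp add: op_form_def flip: linear_diff)
  ultimately show ?thesis
    using assms(2) by (simp add: form_approx_def)
qed

lemma form_domain_eq: "form_domain S = {f. \<exists>p. form_approx S p f}"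
proof (intro set_eqI iffI CollectI; unfold form_domain_def mem_Collect_eq; elim exE conjE)
  fix f p assume p: "\<forall>n. p n \<in> S" "(\<lambda>n. fst (p n)) \<longlonglongrightarrow> f"
    "\<forall>e>0. \<exists>N. \<forall>m\<ge>N. \<forall>n\<ge>N.
       inner (fst (p m) - fst (p n)) (snd (p m) - snd (p n)) + (norm (fst (p m) - fst (p n)))\<^sup>2 < e"
  have "form_approx S p f"
    unfolding form_approx_def op_form_def
  proof (intro conjI allI impI)
    fix e :: real assume "e > 0"
    with p(3) obtain N where N: "\<forall>m\<ge>N. \<forall>n\<ge>N.
       inner (fst (p m) - fst (p n)) (snd (p m) - snd (p n)) + (norm (fst (p m) - fst (p n)))\<^sup>2 < e"
      by blast
    have "inner (fst (p m - p n)) (snd (p m - p n)) < e" if "m \<ge> N" "n \<ge> N" for m n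
      using N[rule_format, OF that] zero_le_power2[of "norm (fst (p m) - fst (p n))"]
      unfolding fst_diff snd_diff by linarith
    then show "\<exists>N. \<forall>m\<ge>N. \<forall>n\<ge>N. inner (fst (p m - p n)) (snd (p m - p n)) < e"
      by blast
  qed (use p in auto)
  then show "\<exists>p. form_approx S p f" by blast
next
  fix f p assume p: "form_approx S p f"
  have "\<exists>N. \<forall>m\<ge>N. \<forall>n\<ge>N. inner (fst (p m) - fst (p n)) (snd (p m) - snd (p n))
        + (norm (fst (p m) - fst (p n)))\<^sup>2 < e" if "e > 0" for e
  proof -
    \<comment> \<open>The norm term is at most 1/\<mu> times the form, so the full form norm squared
      is at most 1 + 1/\<mu> times the form.\<close>
    have pos: "e / (1 + 1 / \<mu>) > 0" using that \<mu> by (simp add: add_pos_pos)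
    then obtain N where N: "\<And>m n. m \<ge> N \<Longrightarrow> n \<ge> N
        \<Longrightarrow> op_form (p m - p n) (p m - p n) < e / (1 + 1 / \<mu>)"
      using p unfolding form_approx_def by meson
    have "op_form (p m - p n) (p m - p n) + (norm (fst (p m - p n)))\<^sup>2 < e"
      if "m \<ge> N" "n \<ge> N" for m n
    proof -
      have "p m - p n \<in> S" using p diff_in by (simp add: form_approx_def)
      from form_ge[OF this]
      have "(norm (fst (p m - p n)))\<^sup>2 \<le> op_form (p m - p n) (p m - p n) / \<mu>"
        using \<mu> by (simp add: field_simps)
      then have "op_form (p m - p n) (p m - p n) + (norm (fst (p m - p n)))\<^sup>2
          \<le> op_form (p m - p n) (p m - p n) * (1 + 1 / \<mu>)"
        by (simp add: algebra_simps)
      also have "\<dots> < e"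
        using N[OF that] \<mu> by (simp add: pos_less_divide_eq add_pos_pos)
      finally show ?thesis .
    qed
    then show ?thesis unfolding op_form_def by auto
  qed
  then show "\<exists>p. (\<forall>n. p n \<in> S) \<and> (\<lambda>n. fst (p n)) \<longlonglongrightarrow> f \<and>
      (\<forall>e>0. \<exists>N. \<forall>m\<ge>N. \<forall>n\<ge>N. inner (fst (p m) - fst (p n)) (snd (p m) - snd (p n))
        + (norm (fst (p m) - fst (p n)))\<^sup>2 < e)"
    using p by (intro exI[of _ p]) (auto simp: form_approx_def)
qed

text \<open>This evaluates the closed form at f and g. The difficulty is that
  \<open>snd (q n)\<close> may be unbounded while \<open>fst (p n) - f\<close> tends to 0.
  Cauchy-Schwarz for the form, applied to p n - p k before k tends to infinity, controls their inner
  product.\<close>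

lemma form_approx_limit:
  assumes p: "form_approx S p f" and q: "form_approx S q g" and fx: "(f, x) \<in> adjoint_op S"
  shows "(\<lambda>n. op_form (p n) (q n)) \<longlonglongrightarrow> inner x g"
proof -
  have pS: "p n \<in> S" and qS: "q n \<in> S" for n using p q by (auto simp: form_approx_def)
  obtain M where M: "\<And>m n. m \<ge> M \<Longrightarrow> n \<ge> M \<Longrightarrow> op_form (q m - q n) (q m - q n) < 1"
    using q zero_less_one unfolding form_approx_def by meson
  \<comment> \<open>Parallelogram bound for q n = (q n - q M) + q M, whose first summand has form
    value below 1.\<close>
  define K where "K = 2 + 2 * op_form (q M) (q M)"
  have K: "op_form (q n) (q n) \<le> K" if "n \<ge> M" for n
    using form_add_le[OF diff_in[OF qS[of n] qS[of M]] qS[of M]] M[OF that order_refl]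
    by (simp add: K_def)
  have "K > 0" using form_nonneg[OF qS[of M]] by (simp add: K_def)
  have small: "\<exists>N. \<forall>n\<ge>N. norm (inner (fst (p n) - f) (snd (q n)) - 0) < e" if "e > 0" for e
  proof -
    \<comment> \<open>This tolerance times K is (e/2)^2. Half of e is kept in reserve because the
      limit in k preserves only the weak inequality.\<close>
    have "e\<^sup>2 / (4 * K) > 0" using that \<open>K > 0\<close> by simp
    then obtain N where N: "\<And>m n. m \<ge> N \<Longrightarrow> n \<ge> N
        \<Longrightarrow> op_form (p m - p n) (p m - p n) < e\<^sup>2 / (4 * K)"
      using p unfolding form_approx_def by meson
    have "\<bar>inner (fst (p n) - f) (snd (q n))\<bar> < e" if n: "n \<ge> max M N" for n
    proof -
      have le: "\<bar>inner (fst (p n) - fst (p k)) (snd (q n))\<bar> \<le> e / 2" if "k \<ge> N" for k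
      proof -
        have "(op_form (p n - p k) (q n))\<^sup>2
            \<le> op_form (p n - p k) (p n - p k) * op_form (q n) (q n)"
          using pS qS diff_in by (intro form_Cauchy_Schwarz) auto
        also have "\<dots> \<le> e\<^sup>2 / (4 * K) * K"
          using N[of n k] K[of n] n that \<open>K > 0\<close> form_nonneg[OF qS]
          by (intro mult_mono) auto
        also have "\<dots> = (e / 2)\<^sup>2" using \<open>K > 0\<close> by (simp add: power2_eq_square)
        finally have "\<bar>op_form (p n - p k) (q n)\<bar> \<le> \<bar>e / 2\<bar>"
          by (simp only: abs_le_square_iff)
        then show ?thesis using \<open>e > 0\<close> by (simp add: op_form_def)
      qed
      have "(\<lambda>k. \<bar>inner (fst (p n) - fst (p k)) (snd (q n))\<bar>)
          \<longlonglongrightarrow> \<bar>inner (fst (p n) - f) (snd (q n))\<bar>"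
        using p unfolding form_approx_def by (intro tendsto_intros) auto
      then have "\<bar>inner (fst (p n) - f) (snd (q n))\<bar> \<le> e / 2"
        by (rule LIMSEQ_le_const2) (use le in blast)
      then show ?thesis using \<open>e > 0\<close> by simp
    qed
    then show ?thesis by (intro exI[of _ "max M N"]) auto
  qed
  have "(\<lambda>n. inner (fst (p n) - f) (snd (q n))) \<longlonglongrightarrow> 0"
    by (rule LIMSEQ_I) (rule small)
  moreover have "(\<lambda>n. inner x (fst (q n))) \<longlonglongrightarrow> inner x g"
    using q unfolding form_approx_def by (intro tendsto_intros) auto
  ultimately have "(\<lambda>n. inner (fst (p n) - f) (snd (q n)) + inner x (fst (q n))) \<longlonglongrightarrow> 0 + inner x g"
    by (rule tendsto_add)
  moreover have "inner (fst (p n) - f) (snd (q n)) + inner x (fst (q n)) = op_form (p n) (q n)" for n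
    using adjoint_opD[OF fx, of "fst (q n)" "snd (q n)"] qS[of n]
      inner_commute[of f "snd (q n)"] inner_commute[of x "fst (q n)"]
    by (simp add: op_form_def inner_diff_left)
  ultimately show ?thesis by simp
qed

lemma SF_D: "(f, y) \<in> SF \<Longrightarrow> (f, y) \<in> adjoint_op S"
  "(f, y) \<in> SF \<Longrightarrow> \<exists>p. form_approx S p f"
  by (auto simp: friedrichs_restriction_def)

lemma S_le_SF: "S \<subseteq> SF"
  using symm form_approx_const by (fastforce simp: friedrichs_restriction_def symmetric_op_iff)

text \<open>A weak solution of S f = x by minimisation: the Riesz sequence for <., x> is Cauchy for
  the form, so its limit is in the form domain, and the weak equation puts the limit in the domain
  of the adjoint.\<close>

lemma Range_SF: "Range SF = UNIV"
proof -
  have "\<exists>f. (f, x) \<in> SF" for x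
  proof -
    define l where "l q = inner (fst q) x" for q :: "'a \<times> 'a"
    have l: "linear l" by (rule linearI) (auto simp: l_def inner_add_left)
    have lb: "(l q)\<^sup>2 \<le> (norm x)\<^sup>2 / \<mu> * op_form q q" if "q \<in> S" for q
    proof -
      have "(l q)\<^sup>2 \<le> (norm (fst q))\<^sup>2 * (norm x)\<^sup>2"
        using Cauchy_Schwarz_ineq[of "fst q" x] by (simp add: l_def power2_norm_eq_inner)
      also have "\<dots> \<le> op_form q q / \<mu> * (norm x)\<^sup>2"
        using form_ge[OF that] \<mu> by (intro mult_right_mono) (auto simp: field_simps)
      finally show ?thesis by (simp add: mult.commute)
    qed
    obtain p where p: "\<And>n. p n \<in> S"
      "\<And>e. e > 0 \<Longrightarrow> \<exists>N. \<forall>m\<ge>N. \<forall>n\<ge>N. op_form (p m - p n) (p m - p n) < e"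
      "\<And>q. q \<in> S \<Longrightarrow> (\<lambda>n. op_form (p n) q) \<longlonglongrightarrow> l q"
      using Riesz_approximating_sequence[OF sub bilinear_op_form form_sym form_nonneg l lb]
      by blast
    have "Cauchy (\<lambda>n. fst (p n))"
    proof (rule Cauchy_squareI[OF \<mu>])
      fix e :: real assume "e > 0"
      from p(2)[OF this] obtain N where N: "\<forall>m\<ge>N. \<forall>n\<ge>N. op_form (p m - p n) (p m - p n) < e"
        by blast
      have "\<mu> * (norm (fst (p m) - fst (p n)))\<^sup>2 < e" if "m \<ge> N" "n \<ge> N" for m n
        using N[rule_format, OF that] form_ge[OF diff_in[OF p(1)[of m] p(1)[of n]]]
        unfolding fst_diff by linarith
      then show "\<exists>N. \<forall>m\<ge>N. \<forall>n\<ge>N. \<mu> * (norm (fst (p m) - fst (p n)))\<^sup>2 < e" by blast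
    qed
    then obtain f where f: "(\<lambda>n. fst (p n)) \<longlonglongrightarrow> f"
      using Cauchy_convergent convergent_def by blast
    have "(f, x) \<in> adjoint_op S"
    proof (rule adjoint_opI)
      fix g y assume gy: "(g, y) \<in> S"
      have "(\<lambda>n. inner (fst (p n)) y) \<longlonglongrightarrow> inner f y" using f by (intro tendsto_intros)
      then show "inner y f = inner g x"
        using LIMSEQ_unique p(3)[OF gy] by (fastforce simp: l_def op_form_def inner_commute)
    qed
    moreover have "form_approx S p f" using p f by (auto simp: form_approx_def)
    ultimately show ?thesis by (auto simp: friedrichs_restriction_def)
  qed
  then show ?thesis by auto
qed

text \<open>The limit of \<open>op_form (p n) (q n)\<close> is computed twice, through the adjoint
  value at f and through the one at g.\<close>

lemma symmetric_SF: "symmetric_op SF"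
proof -
  have "inner f z = inner y g" if fy: "(f, y) \<in> SF" and gz: "(g, z) \<in> SF" for f y g z
  proof -
    obtain p q where p: "form_approx S p f" and q: "form_approx S q g"
      using SF_D fy gz by meson
    have "(\<lambda>n. op_form (q n) (p n)) = (\<lambda>n. op_form (p n) (q n))"
      using p q by (auto simp: form_approx_def intro: form_sym)
    then have "inner y g = inner z f"
      using form_approx_limit[OF p q SF_D(1)[OF fy]] form_approx_limit[OF q p SF_D(1)[OF gz]]
        LIMSEQ_unique by simp
    then show ?thesis by (simp add: inner_commute)
  qed
  then show ?thesis by (auto simp: symmetric_op_def)
qed

lemma SF_ge:
  assumes fy: "(f, y) \<in> SF" and lb: "\<And>f y. (f, y) \<in> S \<Longrightarrow> c * (norm f)\<^sup>2 \<le> inner f y"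
  shows "c * (norm f)\<^sup>2 \<le> inner f y"
proof -
  obtain p where p: "form_approx S p f" using SF_D fy by meson
  have "(\<lambda>n. c * (norm (fst (p n)))\<^sup>2) \<longlonglongrightarrow> c * (norm f)\<^sup>2"
    using p unfolding form_approx_def by (intro tendsto_intros) auto
  moreover have "(\<lambda>n. op_form (p n) (p n)) \<longlonglongrightarrow> inner f y"
    using form_approx_limit[OF p p SF_D(1)[OF fy]] by (simp add: inner_commute)
  moreover have "c * (norm (fst (p n)))\<^sup>2 \<le> op_form (p n) (p n)" for n
    using p lb[of "fst (p n)" "snd (p n)"] by (simp add: form_approx_def op_form_def)
  ultimately show ?thesis by (meson LIMSEQ_le)
qed

lemma admissible_SF: "admissible cplx J SF"
proof -
  have "subspace SF"
  proof (rule subspaceI)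
    show "0 \<in> SF" using S_le_SF subspace_0[OF sub] by auto
    show "x + y \<in> SF" if "x \<in> SF" "y \<in> SF" for x y
      using that subspace_add[OF subspace_adjoint_op, of x S y] form_approx_add
      by (fastforce simp: friedrichs_restriction_def)
    show "c *\<^sub>R x \<in> SF" if "x \<in> SF" for c x
      using that subspace_scale[OF subspace_adjoint_op, of x S c] form_approx_scaleR
      by (fastforce simp: friedrichs_restriction_def)
  qed
  then show ?thesis
    using admissible_adjoint_op[OF J adm] form_approx_J
    by (fastforce simp: friedrichs_restriction_def admissible_def)
qed

lemma densely_defined_extension: "S \<subseteq> T \<Longrightarrow> densely_defined T"
  using dense closure_mono[of "Domain S" "Domain T"] by (auto simp: densely_defined_def)

lemma self_adjoint_SF: "self_adjoint cplx J SF"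
  by (intro self_adjointI_Range admissible_SF densely_defined_extension S_le_SF
      symmetric_SF Range_SF)

text \<open>A candidate T contains S and so lies in the adjoint of S; the domain condition then
  places it inside \<open>SF\<close>, and between self-adjoint operators inclusion is
  equality.\<close>

lemma friedrichs_eq: "friedrichs cplx J S = SF"
  unfolding friedrichs_def
proof (rule the_equality)
  show "self_adjoint cplx J SF \<and> S \<subseteq> SF \<and> Domain SF \<subseteq> form_domain S"
    using self_adjoint_SF S_le_SF SF_D(2) by (auto simp: form_domain_eq)
  fix T assume T: "self_adjoint cplx J T \<and> S \<subseteq> T \<and> Domain T \<subseteq> form_domain S"
  then have "T \<subseteq> adjoint_op S"
    using adjoint_op_antimono[of S T] self_adjointD(4) by blast
  then have "T \<subseteq> SF" using T by (auto simp: form_domain_eq friedrichs_restriction_def)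
  then show "T = SF" using T self_adjoint_SF self_adjoint_maximal by blast
qed

end

section \<open>Square roots of bounded operators\<close>

text \<open>A fixed point Y satisfies 2 Y = E + Y^2, that is (1 - Y)^2 = 1 - E. Every iterate is a
  polynomial in E and inherits its symmetry and its commutation relations.\<close>

fun sqrt_iter :: "('a::real_vector \<Rightarrow> 'a) \<Rightarrow> nat \<Rightarrow> 'a \<Rightarrow> 'a" where
  "sqrt_iter E 0 x = 0"
| "sqrt_iter E (Suc n) x = (1/2) *\<^sub>R (E x + sqrt_iter E n (sqrt_iter E n x))"

text \<open>The same iteration for numbers with \<open>E = 1\<close>, which majorises the norms.\<close>

fun sqrt_majorant :: "nat \<Rightarrow> real" where
  "sqrt_majorant 0 = 0"
| "sqrt_majorant (Suc n) = (1 + (sqrt_majorant n)\<^sup>2) / 2"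

lemma sqrt_majorant_bounds: "0 \<le> sqrt_majorant n" "sqrt_majorant n \<le> 1"
proof -
  have "0 \<le> sqrt_majorant n \<and> sqrt_majorant n \<le> 1"
    by (induction n) (auto intro: power_le_one)
  then show "0 \<le> sqrt_majorant n" "sqrt_majorant n \<le> 1" by auto
qed

lemma incseq_sqrt_majorant: "incseq sqrt_majorant"
proof (rule incseq_SucI)
  fix n
  have "0 \<le> (1 - sqrt_majorant n)\<^sup>2" by simp
  then show "sqrt_majorant n \<le> sqrt_majorant (Suc n)"
    by (simp add: power2_eq_square algebra_simps)
qed

lemma Cauchy_sqrt_majorant: "Cauchy sqrt_majorant"
proof -
  have "Bseq sqrt_majorant"
    using sqrt_majorant_bounds by (intro BseqI'[of _ 1]) auto
  then show ?thesis
    using incseq_sqrt_majorant Bseq_mono_convergent convergent_Cauchy incseq_def by metis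
qed

context
  fixes E :: "'a::real_inner \<Rightarrow> 'a"
  assumes E: "linear E" and E_le: "\<And>x. norm (E x) \<le> norm x"
begin

lemma linear_sqrt_iter: "linear (sqrt_iter E n)"
proof (induction n)
  case (Suc n)
  then show ?case
    using E by (intro linearI) (simp_all add: linear_add linear_cmul algebra_simps)
qed (auto intro: linearI)

lemma norm_sqrt_iter: "norm (sqrt_iter E n x) \<le> sqrt_majorant n * norm x"
proof (induction n arbitrary: x)
  case (Suc n)
  let ?Y = "sqrt_iter E n" and ?y = "sqrt_majorant n"
  have "norm (?Y (?Y x)) \<le> ?y * (?y * norm x)"
    using Suc[of "?Y x"] mult_left_mono[OF Suc[of x] sqrt_majorant_bounds(1)[of n]] by linarith
  then have "norm (E x + ?Y (?Y x)) \<le> norm x + ?y * (?y * norm x)"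
    using norm_triangle_ineq[of "E x" "?Y (?Y x)"] E_le[of x] by linarith
  also have "\<dots> = 2 * (sqrt_majorant (Suc n) * norm x)"
    by (simp add: power2_eq_square algebra_simps)
  finally show ?case by (simp del: scaleR_add_right sqrt_majorant.simps)
qed auto

text \<open>Rests on Z Z - Y Y = Z (Z - Y) + (Z - Y) Y, whose numerical counterpart is z^2 - y^2.
  Telescoped, it makes the iteration Cauchy because the scalar one is.\<close>

lemma norm_sqrt_iter_Suc_diff:
  "norm (sqrt_iter E (Suc n) x - sqrt_iter E n x)
    \<le> (sqrt_majorant (Suc n) - sqrt_majorant n) * norm x"
proof (induction n arbitrary: x)
  case 0
  then show ?case using E_le[of x] by simp
next
  case (Suc n)
  define Y y Z z where "Y = sqrt_iter E n" and "y = sqrt_majorant n"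
    and "Z = sqrt_iter E (Suc n)" and "z = sqrt_majorant (Suc n)"
  note defs = Y_def Z_def y_def z_def
  have IH: "norm (Z x - Y x) \<le> (z - y) * norm x" for x using Suc by (simp only: defs)
  have le: "norm (Y x) \<le> y * norm x" "norm (Z x) \<le> z * norm x" "0 \<le> z" "y \<le> z" for x
    using norm_sqrt_iter sqrt_majorant_bounds(1) incseq_SucD[OF incseq_sqrt_majorant]
    by (simp_all only: defs)
  have "norm (Z (Z x - Y x)) \<le> z * ((z - y) * norm x)"
    using le(2)[of "Z x - Y x"] mult_left_mono[OF IH[of x] le(3)] by linarith
  moreover have "norm (Z (Y x) - Y (Y x)) \<le> (z - y) * (y * norm x)"
  proof -
    have "(z - y) * norm (Y x) \<le> (z - y) * (y * norm x)"
      using le by (intro mult_left_mono) auto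
    then show ?thesis using IH[of "Y x"] by linarith
  qed
  moreover have "Z (Z x) - Y (Y x) = Z (Z x - Y x) + (Z (Y x) - Y (Y x))"
    using linear_sqrt_iter[of "Suc n"] by (simp add: Z_def linear_diff del: sqrt_iter.simps)
  ultimately have "norm (Z (Z x) - Y (Y x)) \<le> z * ((z - y) * norm x) + (z - y) * (y * norm x)"
    by (simp only: norm_triangle_mono)
  also have "\<dots> = (z\<^sup>2 - y\<^sup>2) * norm x" by (simp add: power2_eq_square algebra_simps)
  finally have *: "norm (Z (Z x) - Y (Y x)) \<le> (z\<^sup>2 - y\<^sup>2) * norm x" .
  have "sqrt_iter E (Suc (Suc n)) x - Z x = (1/2) *\<^sub>R (Z (Z x) - Y (Y x))"
    unfolding Z_def Y_def by (simp add: algebra_simps)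
  then have "norm (sqrt_iter E (Suc (Suc n)) x - Z x) = (1/2) * norm (Z (Z x) - Y (Y x))" by simp
  also have "\<dots> \<le> (1/2) * ((z\<^sup>2 - y\<^sup>2) * norm x)" using * by simp
  also have "\<dots> = ((1 + z\<^sup>2) / 2 - (1 + y\<^sup>2) / 2) * norm x" by (simp add: field_simps)
  also have "\<dots> = (sqrt_majorant (Suc (Suc n)) - sqrt_majorant (Suc n)) * norm x"
    by (simp add: y_def z_def)
  finally show ?case by (simp only: defs)
qed

lemma norm_sqrt_iter_diff:
  "n \<le> m \<Longrightarrow> norm (sqrt_iter E m x - sqrt_iter E n x) \<le> (sqrt_majorant m - sqrt_majorant n) * norm x"
proof (induction m rule: dec_induct)
  case (step m)
  have "norm (sqrt_iter E (Suc m) x - sqrt_iter E n x)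
      \<le> norm (sqrt_iter E (Suc m) x - sqrt_iter E m x) + norm (sqrt_iter E m x - sqrt_iter E n x)"
    by (rule norm_diff_triangle_ineq[of _ "sqrt_iter E m x" "sqrt_iter E m x", simplified])
  also have "\<dots> \<le> (sqrt_majorant (Suc m) - sqrt_majorant n) * norm x"
    using step.IH norm_sqrt_iter_Suc_diff[of m x] by (simp add: left_diff_distrib)
  finally show ?case .
qed simp

lemma Cauchy_sqrt_iter: "Cauchy (\<lambda>n. sqrt_iter E n x)"
proof (rule metric_CauchyI)
  fix e :: real assume "e > 0"
  then have "e / (norm x + 1) > 0" by (simp add: add_nonneg_pos)
  then obtain N where N: "\<And>m n. m \<ge> N \<Longrightarrow> n \<ge> N
      \<Longrightarrow> dist (sqrt_majorant m) (sqrt_majorant n) < e / (norm x + 1)"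
    using Cauchy_sqrt_majorant unfolding Cauchy_def by meson
  have *: "dist (sqrt_iter E m x) (sqrt_iter E n x) < e" if "m \<ge> n" "n \<ge> N" for m n
  proof -
    have "norm (sqrt_iter E m x - sqrt_iter E n x) \<le> (sqrt_majorant m - sqrt_majorant n) * norm x"
      using norm_sqrt_iter_diff that(1) .
    also have "\<dots> \<le> e / (norm x + 1) * norm x"
      using N[of m n] that by (intro mult_right_mono) (auto simp: dist_real_def)
    also have "\<dots> < e"
      using \<open>e > 0\<close> pos_divide_less_eq[of "norm x + 1" "e * norm x" e]
      by (simp add: algebra_simps add_pos_nonneg)
    finally show ?thesis by (simp add: dist_norm)
  qed
  then show "\<exists>N. \<forall>m\<ge>N. \<forall>n\<ge>N. dist (sqrt_iter E m x) (sqrt_iter E n x) < e"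
    by (intro exI[of _ N]) (metis dist_commute nle_le)
qed

end

text \<open>\<open>Y\<close> is \<open>1 - sqrt (1 - E)\<close>.\<close>

lemma contraction_sqrt:
  fixes E :: "'a::{real_inner, complete_space} \<Rightarrow> 'a"
  assumes E: "linear E" and E_le: "\<And>x. norm (E x) \<le> norm x"
    and E_sym: "\<And>x y. inner (E x) y = inner x (E y)"
  obtains Y where "bounded_linear Y" "\<And>x. norm (Y x) \<le> norm x"
    "\<And>x y. inner (Y x) y = inner x (Y y)"
    "\<And>x. 2 *\<^sub>R Y x = E x + Y (Y x)"
    "\<forall>X. bounded_linear X \<longrightarrow> (\<forall>x. X (E x) = E (X x)) \<longrightarrow> (\<forall>x. X (Y x) = Y (X x))"
proof -
  define Y where "Y x = lim (\<lambda>n. sqrt_iter E n x)" for x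
  have Y: "(\<lambda>n. sqrt_iter E n x) \<longlonglongrightarrow> Y x" for x
    using Cauchy_convergent[OF Cauchy_sqrt_iter[OF E E_le]] unfolding Y_def convergent_LIMSEQ_iff .
  note lin = linear_sqrt_iter[OF E E_le]
  have le1: "norm (sqrt_iter E n x) \<le> norm x" for n x
    using norm_sqrt_iter[OF E E_le, of n x] mult_right_mono[OF sqrt_majorant_bounds(2)[of n], of "norm x"]
    by simp
  have add: "Y (x + y) = Y x + Y y" for x y
    using Y[of "x + y"] tendsto_add[OF Y[of x] Y[of y]] linear_add[OF lin]
    by (simp add: LIMSEQ_unique)
  have scale: "Y (c *\<^sub>R x) = c *\<^sub>R Y x" for c x
    using Y[of "c *\<^sub>R x"] tendsto_scaleR[OF tendsto_const Y[of x], of c] linear_cmul[OF lin]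
    by (simp add: LIMSEQ_unique)
  have Y_le: "norm (Y x) \<le> norm x" for x
    using tendsto_norm[OF Y[of x]] by (rule LIMSEQ_le_const2) (use le1 in auto)
  have bl: "bounded_linear Y"
    using add scale Y_le by (intro bounded_linear_intro[of _ 1]) auto
  have iter_sym: "inner (sqrt_iter E n x) y = inner x (sqrt_iter E n y)" for n x y
    by (induction n arbitrary: x y) (auto simp: inner_add_left inner_add_right E_sym)
  have sym: "inner (Y x) y = inner x (Y y)" for x y
    using LIMSEQ_unique[OF tendsto_inner[OF Y[of x] tendsto_const[of y]]]
      tendsto_inner[OF tendsto_const[of x] Y[of y]] by (simp add: iter_sym)
  \<comment> \<open>Operator and argument both vary with n; since all iterates are contractions, the
    inner one may be replaced by its limit.\<close>
  have "(\<lambda>n. sqrt_iter E n (sqrt_iter E n x)) \<longlonglongrightarrow> Y (Y x)" for x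
  proof (rule Lim_transform2)
    show "(\<lambda>n. sqrt_iter E n (Y x)) \<longlonglongrightarrow> Y (Y x)" by (rule Y)
    have 1: "norm (sqrt_iter E n (Y x) - sqrt_iter E n (sqrt_iter E n x)) \<le> norm (Y x - sqrt_iter E n x)" for n
      using le1[of n "Y x - sqrt_iter E n x"] by (simp add: linear_diff[OF lin])
    have 2: "(\<lambda>n. norm (Y x - sqrt_iter E n x)) \<longlonglongrightarrow> 0"
      using tendsto_norm[OF tendsto_diff[OF tendsto_const[of "Y x"] Y[of x]]] by simp
    show "(\<lambda>n. sqrt_iter E n (Y x) - sqrt_iter E n (sqrt_iter E n x)) \<longlonglongrightarrow> 0"
      by (rule Lim_null_comparison[OF always_eventually[OF allI[OF 1]] 2])
  qed
  then have "(\<lambda>n. sqrt_iter E (Suc n) x) \<longlonglongrightarrow> (1/2) *\<^sub>R (E x + Y (Y x))" for x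
    by (auto intro!: tendsto_intros)
  then have half: "Y x = (1/2) *\<^sub>R (E x + Y (Y x))" for x
    using LIMSEQ_Suc[OF Y[of x]] LIMSEQ_unique by blast
  have eq: "2 *\<^sub>R Y x = E x + Y (Y x)" for x
    using arg_cong[OF half[of x], of "scaleR 2"] by (simp del: scaleR_add_right)
  have comm: "X (Y x) = Y (X x)" if X: "bounded_linear X" "\<And>x. X (E x) = E (X x)" for X x
  proof -
    have "X (sqrt_iter E n x) = sqrt_iter E n (X x)" for n x
      by (induction n arbitrary: x)
        (simp_all add: X linear_add[OF bounded_linear.linear[OF X(1)]]
          linear_cmul[OF bounded_linear.linear[OF X(1)]] linear_0[OF bounded_linear.linear[OF X(1)]])
    then show ?thesis
      using bounded_linear.tendsto[OF X(1) Y[of x]] Y[of "X x"] LIMSEQ_unique by simp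
  qed
  show thesis by (rule that[OF bl Y_le sym eq]) (use comm in blast)
qed

section \<open>Square roots of unbounded operators\<close>

text \<open>For symmetric K the contraction hypothesis says 0 \<le> K \<le> 2. C satisfies the
  hypotheses made on K, so the lemma can be applied to its own result, which yields a fourth root
  later.\<close>

lemma positive_sqrt:
  fixes K :: "'a::{real_inner, complete_space} \<Rightarrow> 'a"
  assumes K: "linear K" and K_le: "\<And>x. norm (x - K x) \<le> norm x"
    and K_sym: "\<And>x y. inner (K x) y = inner x (K y)"
  obtains C where "bounded_linear C" "\<And>x. norm (x - C x) \<le> norm x"
    "\<And>x y. inner (C x) y = inner x (C y)"
    "\<And>x. C (C x) = K x"
    "\<forall>X. bounded_linear X \<longrightarrow> (\<forall>x. X (K x) = K (X x)) \<longrightarrow> (\<forall>x. X (C x) = C (X x))"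
proof -
  have lin: "linear (\<lambda>x. x - K x)"
    using K by (intro linear_compose_sub linear_ident)
  have sym: "inner (x - K x) y = inner x (y - K y)" for x y
    by (simp add: inner_diff_left inner_diff_right K_sym)
  obtain Y where Y: "bounded_linear Y" "\<And>x. norm (Y x) \<le> norm x"
    "\<And>x y. inner (Y x) y = inner x (Y y)"
    "\<And>x. 2 *\<^sub>R Y x = x - K x + Y (Y x)"
    "\<forall>X. bounded_linear X \<longrightarrow> (\<forall>x. X (x - K x) = X x - K (X x)) \<longrightarrow> (\<forall>x. X (Y x) = Y (X x))"
    by (rule contraction_sqrt[OF lin K_le sym], rule that)
  show thesis
  proof (rule that[of "\<lambda>x. x - Y x"])
    show "bounded_linear (\<lambda>x. x - Y x)"
      using Y(1) by (intro bounded_linear_sub bounded_linear_ident)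
    show "norm (x - (x - Y x)) \<le> norm x" for x using Y(2) by simp
    show "inner (x - Y x) y = inner x (y - Y y)" for x y
      by (simp add: inner_diff_left inner_diff_right Y(3))
    show "x - Y x - Y (x - Y x) = K x" for x
    proof -
      have "x - Y x - Y (x - Y x) = x - 2 *\<^sub>R Y x + Y (Y x)"
        using Y(1) by (simp add: linear_diff bounded_linear.linear scaleR_2)
      then show ?thesis by (simp add: Y(4))
    qed
    show "\<forall>X. bounded_linear X \<longrightarrow> (\<forall>x. X (K x) = K (X x)) \<longrightarrow>
        (\<forall>x. X (x - Y x) = X x - Y (X x))"
      using Y(5) by (simp add: linear_diff bounded_linear.linear)
  qed
qed

text \<open>Cauchy-Schwarz for the form of Q, between y and Q y, bounds |Q y|^4 by a multiple of <Q
  y, y>.\<close>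

lemma symmetric_nonneg_eq_0:
  fixes Q :: "'a::real_inner \<Rightarrow> 'a"
  assumes Q: "linear Q" and sym: "\<And>x y. inner (Q x) y = inner x (Q y)"
    and nonneg: "\<And>x. 0 \<le> inner (Q x) x" and "inner (Q y) y = 0"
  shows "Q y = 0"
proof -
  have "bilinear (\<lambda>x y. inner (Q x) y)"
    using Q by (auto simp: bilinear_def inner_add_left inner_add_right linear_add linear_cmul
        intro!: linearI)
  then have "(inner (Q y) (Q y))\<^sup>2 \<le> inner (Q y) y * inner (Q (Q y)) (Q y)"
    by (rule bilinear_Cauchy_Schwarz[OF subspace_UNIV])
      (metis sym inner_commute, simp_all add: nonneg)
  then show ?thesis using assms(4) by simp
qed

text \<open>With y = (Q - K) x, commutation gives (Q + K) y = 0. Two nonnegative forms with sum zero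
  at y vanish there separately, so Q y = K y = 0 and <y, y> = <x, (Q - K) y> = 0.\<close>

lemma positive_sqrt_unique:
  fixes Q K :: "'a::real_inner \<Rightarrow> 'a"
  assumes Q: "linear Q" "\<And>x y. inner (Q x) y = inner x (Q y)" "\<And>x. 0 \<le> inner (Q x) x"
    and K: "linear K" "\<And>x y. inner (K x) y = inner x (K y)" "\<And>x. 0 \<le> inner (K x) x"
    and comm: "\<And>x. Q (K x) = K (Q x)" and sq: "\<And>x. Q (Q x) = K (K x)"
  shows "Q = K"
proof
  fix x
  define y where "y = Q x - K x"
  have "Q y + K y = 0"
    using Q(1) K(1) by (simp add: y_def linear_diff comm sq)
  then have "inner (Q y) y + inner (K y) y = 0" by (metis inner_add_left inner_zero_left)
  then have "inner (Q y) y = 0" "inner (K y) y = 0"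
    using Q(3)[of y] K(3)[of y] by linarith+
  then have "Q y = 0" "K y = 0"
    using symmetric_nonneg_eq_0[OF Q] symmetric_nonneg_eq_0[OF K] by auto
  then have "inner y y = 0"
    using Q(2)[of x y] K(2)[of x y] by (simp add: y_def inner_diff_left)
  then show "Q x = K x" by (simp add: y_def)
qed

section \<open>Shifts, and the square root as a quotient of bounded operators\<close>

lemma mem_shift_op: "(x, z) \<in> shift_op T c \<longleftrightarrow> (x, z + c *\<^sub>R x) \<in> T"
  by (force simp: shift_op_def)

lemma self_adjoint_shift_op:
  assumes J: "cplx \<longrightarrow> orth_complex_structure J" and T: "self_adjoint cplx J T"
  shows "self_adjoint cplx J (shift_op T c)"
proof -
  note T' = self_adjointD[OF T]
  have "subspace (shift_op T c)"
  proof (rule subspaceI)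
    show "0 \<in> shift_op T c"
      using subspace_0[OF T'(1)] by (simp add: mem_shift_op zero_prod_def)
    show "x + y \<in> shift_op T c" if "x \<in> shift_op T c" "y \<in> shift_op T c" for x y
      using that subspace_add[OF T'(1)] by (cases x; cases y) (force simp: mem_shift_op algebra_simps)
    show "r *\<^sub>R x \<in> shift_op T c" if "x \<in> shift_op T c" for r x
      using that subspace_scale[OF T'(1), of "(fst x, snd x + c *\<^sub>R fst x)" r]
      by (cases x) (simp add: mem_shift_op algebra_simps)
  qed
  moreover have "(J x, J z) \<in> shift_op T c" if "cplx" "(x, z) \<in> shift_op T c" for x z
  proof -
    have "linear J" using J that(1) orth_complex_structureD(1) by auto
    moreover have "(J x, J (z + c *\<^sub>R x)) \<in> T"
      using that T'(5) by (auto simp: mem_shift_op admissible_def)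
    ultimately show ?thesis by (simp add: mem_shift_op linear_add linear_cmul)
  qed
  moreover have "y = z" if "(x, y) \<in> shift_op T c" "(x, z) \<in> shift_op T c" for x y z
    using that T'(7) by (fastforce simp: mem_shift_op)
  moreover have "Domain (shift_op T c) = Domain T"
    by (force simp: shift_op_def)
  moreover have "adjoint_op (shift_op T c) = shift_op T c"
  proof -
    have "(\<forall>(f, y)\<in>shift_op T c. inner y g = inner f h)
        \<longleftrightarrow> (\<forall>(f, y)\<in>T. inner (y - c *\<^sub>R f) g = inner f h)" for g h
      unfolding shift_op_def by blast
    then have "(g, h) \<in> adjoint_op (shift_op T c) \<longleftrightarrow> (g, h + c *\<^sub>R g) \<in> adjoint_op T" for g h
      by (simp add: adjoint_op_def inner_diff_left inner_add_right diff_eq_eq)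
    then show ?thesis unfolding T'(4) by (auto simp: mem_shift_op)
  qed
  ultimately show ?thesis
    using T'(3) by (auto simp: self_adjoint_def lin_op_def admissible_def densely_defined_def)
qed

lemma nonneg_opD: "nonneg_op G \<Longrightarrow> (f, g) \<in> G \<Longrightarrow> 0 \<le> inner f g"
  by (auto simp: nonneg_op_def)

text \<open>\<open>C\<close> and \<open>D\<close> are the square roots of \<open>inverse (1 + A)\<close> and \<open>A * inverse (1 + A)\<close>, so
  that the square root of \<open>A\<close> is \<open>D * inverse C\<close>.\<close>

locale sqrt_factors =
  fixes cplx :: bool and J :: "'a::{real_inner, complete_space} \<Rightarrow> 'a"
    and A :: "('a \<times> 'a) set" and C D :: "'a \<Rightarrow> 'a"
  assumes J: "cplx \<longrightarrow> orth_complex_structure J"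
    and A: "self_adjoint cplx J A" and A_nonneg: "nonneg_op A"
    and C: "bounded_linear C" and D: "bounded_linear D"
    and C_sym: "inner (C x) y = inner x (C y)" and D_sym: "inner (D x) y = inner x (D y)"
    and sum_sq: "C (C x) + D (D x) = x"
    and CD: "C (D x) = D (C x)"
    and CD_nonneg: "0 \<le> inner (C x) (D x)"
    and in_A: "(C (C x), D (D x)) \<in> A"
    and C_A: "(f, y) \<in> A \<Longrightarrow> C (C (f + y)) = f"
    and commute: "bounded_linear X \<Longrightarrow> (\<And>x. X (C (C x)) = C (C (X x)))
      \<Longrightarrow> X (C x) = C (X x) \<and> X (D x) = D (X x)"
begin

lemmas linC [simp] = linear_add[OF bounded_linear.linear[OF C]]
  linear_cmul[OF bounded_linear.linear[OF C]] linear_diff[OF bounded_linear.linear[OF C]]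
  linear_0[OF bounded_linear.linear[OF C]]
lemmas linD [simp] = linear_add[OF bounded_linear.linear[OF D]]
  linear_cmul[OF bounded_linear.linear[OF D]] linear_diff[OF bounded_linear.linear[OF D]]
  linear_0[OF bounded_linear.linear[OF D]]

text \<open>The equation says that h is the inverse of C applied to D g, without mentioning an
  inverse.\<close>

definition R :: "('a \<times> 'a) set" where "R = {(g, h). D g = C h}"

lemma C_eq_0: "C x = 0 \<Longrightarrow> x = 0"
proof -
  assume x: "C x = 0"
  then have "D (D x) = x" using sum_sq[of x] by simp
  then have "(0, x) \<in> A" using in_A[of x] x by simp
  moreover have "(0, 0) \<in> A"
    using subspace_0[OF self_adjointD(1)[OF A]] by (simp add: zero_prod_def)
  ultimately show "x = 0" using self_adjointD(7)[OF A] by blast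
qed

lemma C_eqD: "C x = C y \<Longrightarrow> x = y"
  using C_eq_0[of "x - y"] by simp

lemma Domain_A: "(f, y) \<in> A \<Longrightarrow> \<exists>x. f = C (C x) \<and> y = D (D x)"
  using C_A[of f y] sum_sq[of "f + y"] by (intro exI[of _ "f + y"]) (metis add_left_cancel)

text \<open>A pair with D g = C h is the image of x = C g + D h, by C^2 + D^2 = 1 and commutation.
  In this parametrised form the adjoint of R can be read off.\<close>

lemma R_range: "R = range (\<lambda>x. (C x, D x))"
proof (intro subset_antisym subsetI)
  fix p assume "p \<in> R"
  then have *: "D (fst p) = C (snd p)" by (auto simp: R_def)
  have "C (C (fst p) + D (snd p)) = fst p" "D (C (fst p) + D (snd p)) = snd p"
    using sum_sq[of "fst p"] sum_sq[of "snd p"] CD[of "snd p"] CD[of "fst p"] *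
    by (simp_all add: add.commute)
  then show "p \<in> range (\<lambda>x. (C x, D x))"
    by (intro range_eqI[of _ _ "C (fst p) + D (snd p)"]) (simp add: prod_eq_iff del: linC linD)
qed (auto simp: R_def CD)

lemma self_adjoint_R: "self_adjoint cplx J R"
proof -
  have "subspace R"
    by (rule subspaceI) (auto simp: R_def zero_prod_def)
  moreover have "(J g, J h) \<in> R" if "cplx" "(g, h) \<in> R" for g h
  proof -
    have J': "orth_complex_structure J" using J that(1) by simp
    have "bounded_linear J" using J' by (rule orth_complex_structure_bounded_linear)
    \<comment> \<open>C^2 is the resolvent of A at -1 and A is J-invariant, so J commutes with it;
      \<open>commute\<close> passes this on to C and D.\<close>
    moreover have "J (C (C x)) = C (C (J x))" for x
    proof -
      have "(J (C (C x)), J (D (D x))) \<in> A"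
        using in_A[of x] self_adjointD(5)[OF A] that(1) by (auto simp: admissible_def)
      from C_A[OF this] show ?thesis
        using sum_sq[of x] linear_add[OF orth_complex_structureD(1)[OF J']] by metis
    qed
    ultimately have "J (C x) = C (J x)" "J (D x) = D (J x)" for x
      using commute by blast+
    then show ?thesis using that(2) unfolding R_def by (metis case_prodD case_prodI mem_Collect_eq)
  qed
  moreover have "y = z" if "(x, y) \<in> R" "(x, z) \<in> R" for x y z
    using that by (auto simp: R_def intro: C_eqD)
  moreover have "Domain A \<subseteq> Domain R"
  proof
    fix f assume "f \<in> Domain A"
    then obtain x where "f = C (C x)" using Domain_A by blast
    then show "f \<in> Domain R" by (auto simp: R_range)
  qed
  then have "densely_defined R"
    using self_adjointD(3)[OF A] closure_mono[of "Domain A" "Domain R"]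
    by (auto simp: densely_defined_def)
  moreover have "adjoint_op R = R"
  proof -
    have "(g, h) \<in> adjoint_op R \<longleftrightarrow> (\<forall>x. inner x (D g) = inner x (C h))" for g h
      by (auto simp: adjoint_op_def R_range D_sym C_sym)
    then have "(g, h) \<in> adjoint_op R \<longleftrightarrow> D g = C h" for g h
      by (metis inner_commute vector_eq_ldot)
    then show ?thesis by (auto simp: R_def)
  qed
  ultimately show ?thesis
    by (auto simp: self_adjoint_def lin_op_def admissible_def)
qed

lemma R_O_R: "R O R = A"
proof (intro subset_antisym subrelI)
  fix g k assume "(g, k) \<in> R O R"
  then obtain h where h: "D g = C h" "D h = C k" by (auto simp: R_def)
  have "C (C (g + k)) = C (C g) + D (D g)"
    using h CD[of h] by simp
  then have *: "C (C (g + k)) = g" using sum_sq by simp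
  then have "D (D (g + k)) = k" using sum_sq[of "g + k"] by (metis add_left_cancel)
  then show "(g, k) \<in> A" using in_A[of "g + k"] * by simp
next
  fix f y assume "(f, y) \<in> A"
  then obtain x where "f = C (C x)" "y = D (D x)" using Domain_A by blast
  then show "(f, y) \<in> R O R"
    by (intro relcompI[of _ "D (C x)"]) (auto simp: R_def CD)
qed

text \<open>P is unbounded, so it is compared with R after composition with the resolvent: Q = P C^2
  is bounded and equals C D = R C^2 by uniqueness of bounded nonnegative roots. Symmetry of P and
  injectivity of C then give P inside R.\<close>

lemma sqrt_unique:
  assumes P: "self_adjoint cplx J P" "nonneg_op P" "P O P = A"
  shows "P = R"
proof -
  note P' = self_adjointD[OF P(1)]
  have sub: "(f - f', y - y') \<in> P" if "(f, y) \<in> P" "(f', y') \<in> P" for f y f' y'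
    using subspace_diff[OF P'(1) that] by simp
  have "\<exists>y. (C (C x), y) \<in> P \<and> (y, D (D x)) \<in> P" for x
    using in_A[of x] unfolding P(3)[symmetric] by blast
  then obtain Q where Q: "\<And>x. (C (C x), Q x) \<in> P" "\<And>x. (Q x, D (D x)) \<in> P" by metis
  have Q_eq: "(C (C x), y) \<in> P \<Longrightarrow> y = Q x" for x y using P'(7) Q(1) by blast
  have symP: "inner f z = inner y g" if "(f, y) \<in> P" "(g, z) \<in> P" for f y g z
    using symmetric_opD[OF P'(2) that] .
  have Q_add: "Q (x + y) = Q x + Q y" for x y
    using Q_eq[of "x + y"] subspace_add[OF P'(1) Q(1)[of x] Q(1)[of y]] by simp
  have Q_scale: "Q (c *\<^sub>R x) = c *\<^sub>R Q x" for c x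
    using Q_eq[of "c *\<^sub>R x" "c *\<^sub>R Q x"] subspace_scale[OF P'(1) Q(1)[of x], of c] by simp
  have linQ: "linear Q" using Q_add Q_scale by (intro linearI)
  \<comment> \<open>In y = C^2 y + D^2 y the first part lies in the domain of P and the second in
    its range, so symmetry and nonnegativity of P apply to each.\<close>
  have Q_inner: "inner (Q x) y = inner (Q x) (C (C y)) + inner (Q x) (D (D y))" for x y
    using sum_sq[of y] by (metis inner_add_right)
  have Q_sym: "inner (Q x) y = inner x (Q y)" for x y
  proof -
    have "inner (Q x) (C (C y)) = inner (C (C x)) (Q y)"
      using symP[OF Q(1)[of x] Q(1)[of y]] by simp
    moreover have "inner (Q x) (D (D y)) = inner (D (D x)) (Q y)"
      using symP[OF Q(2)[of x] Q(2)[of y]] by simp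
    ultimately show ?thesis using Q_inner[of x y] sum_sq[of x] by (metis inner_add_left)
  qed
  have Q_nonneg: "0 \<le> inner (Q x) x" for x
    using Q_inner[of x x] nonneg_opD[OF P(2) Q(1)[of x]] nonneg_opD[OF P(2) Q(2)[of x]]
    by (simp add: inner_commute)
  have QQ: "inner (Q x) (Q x) = inner (C (D x)) (C (D x))" for x
    using symP[OF Q(1)[of x] Q(2)[of x]] by (simp add: C_sym D_sym CD)
  have norm_CD: "(norm (C x))\<^sup>2 + (norm (D x))\<^sup>2 = (norm x)\<^sup>2" for x
    using arg_cong[OF sum_sq[of x], of "inner x"]
    by (simp add: power2_norm_eq_inner inner_add_right C_sym D_sym)
  then have "norm (C x) \<le> norm x" "norm (D x) \<le> norm x" for x
    by (metis norm_ge_zero power2_le_imp_le le_add_same_cancel1 le_add_same_cancel2 zero_le_power2)+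
  then have "norm (Q x) \<le> norm x" for x
    using QQ[of x] order_trans by (metis norm_eq_sqrt_inner)
  then have blQ: "bounded_linear Q"
    using Q_add Q_scale by (intro bounded_linear_intro[of _ 1]) auto
  \<comment> \<open>The computation is (1 + A) Q C^2 x = Q x, from C^2 - C^4 = D^2 C^2 and A = P
    P.\<close>
  have QB: "Q (C (C x)) = C (C (Q x))" for x
  proof -
    have "(C (C x) - C (C (C (C x))), Q x - Q (C (C x))) \<in> P"
      using sub Q(1) by blast
    moreover have "C (C x) - C (C (C (C x))) = D (D (C (C x)))"
      using sum_sq[of "C (C x)"] by (metis add_diff_cancel_left')
    ultimately have "(Q (C (C x)), Q x - Q (C (C x))) \<in> P O P"
      using Q(2)[of "C (C x)"] by (auto intro: relcompI)
    from C_A[OF this[unfolded P(3)]] show ?thesis by simp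
  qed
  have QC: "Q (C x) = C (Q x)" and QD: "Q (D x) = D (Q x)" for x
    using commute[OF blQ QB] by auto
  have "(C (C (Q x)), D (D (C (C x)))) \<in> P" for x
    using Q(2)[of "C (C x)"] by (simp add: QC)
  then have Q_sq: "Q (Q x) = C (D (C (D x)))" for x
    using Q_eq CD by metis
  have "Q = (\<lambda>x. C (D x))"
  proof (rule positive_sqrt_unique[OF linQ Q_sym Q_nonneg])
    show "linear (\<lambda>x. C (D x))" by (rule linearI) auto
    show "inner (C (D x)) y = inner x (C (D y))" for x y by (simp add: C_sym D_sym CD)
    show "0 \<le> inner (C (D x)) x" for x using CD_nonneg[of x] by (simp add: C_sym inner_commute)
  qed (auto simp: Q_sq QC QD)
  then have Q_CD: "Q x = C (D x)" for x by simp
  have "P \<subseteq> R"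
  proof (rule subrelI)
    fix g h assume gh: "(g, h) \<in> P"
    have "inner x (Q g) = inner x (C (C h))" for x
      using symP[OF Q(1)[of x] gh] by (simp add: C_sym Q_sym)
    then have "C (D g) = C (C h)" unfolding Q_CD by (metis inner_commute vector_eq_ldot)
    then show "(g, h) \<in> R" by (auto simp: R_def intro: C_eqD)
  qed
  then show ?thesis by (rule self_adjoint_maximal[OF P(1) self_adjoint_R])
qed

lemma op_sqrt_eq: "op_sqrt cplx J A = R"
  unfolding op_sqrt_def
proof (rule the_equality)
  have "nonneg_op R" by (auto simp: nonneg_op_def R_range CD_nonneg)
  then show "self_adjoint cplx J R \<and> nonneg_op R \<and> R O R = A"
    using self_adjoint_R R_O_R by simp
qed (use sqrt_unique in blast)

lemma Range_R_iff:
  "u \<in> Range R \<longleftrightarrow> (\<exists>c. \<forall>(f, y)\<in>A. (inner f u)\<^sup>2 \<le> c * inner f y)"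
proof
  assume "u \<in> Range R"
  then obtain g where g: "(g, u) \<in> R" by blast
  have "(inner f u)\<^sup>2 \<le> inner g g * inner f y" if "(f, y) \<in> A" for f y
  proof -
    obtain w where w: "(f, w) \<in> R" "(w, y) \<in> R" using \<open>(f, y) \<in> A\<close> R_O_R by blast
    note sym = symmetric_opD[OF self_adjointD(2)[OF self_adjoint_R]]
    have "inner f u = inner w g" "inner f y = inner w w" using sym w g by auto
    then show ?thesis using Cauchy_Schwarz_ineq[of w g] by (simp add: mult.commute)
  qed
  then show "\<exists>c. \<forall>(f, y)\<in>A. (inner f u)\<^sup>2 \<le> c * inner f y" by blast
next
  assume "\<exists>c. \<forall>(f, y)\<in>A. (inner f u)\<^sup>2 \<le> c * inner f y"
  then obtain c where c: "\<And>f y. (f, y) \<in> A \<Longrightarrow> (inner f u)\<^sup>2 \<le> c * inner f y" by blast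
  have cont: "continuous_on UNIV C" "continuous_on UNIV D"
    using C D by (auto intro: linear_continuous_on)
  \<comment> \<open>At f = C z the hypothesis involves only bounded operators. It holds for z in the
    domain of A and extends to all z by density.\<close>
  have "closure (Domain A) \<subseteq> {z. (inner (C z) u)\<^sup>2 \<le> c * (norm (D z))\<^sup>2}"
  proof (rule closure_minimal)
    show "closed {z. (inner (C z) u)\<^sup>2 \<le> c * (norm (D z))\<^sup>2}"
      using cont by (intro closed_Collect_le continuous_intros)
    have "(inner (C (C (C x))) u)\<^sup>2 \<le> c * (norm (D (C (C x))))\<^sup>2" for x
    proof -
      have "inner (C (C (C x))) (D (D (C x))) = (norm (D (C (C x))))\<^sup>2"
        by (simp add: power2_norm_eq_inner C_sym D_sym CD)
      then show ?thesis using c[OF in_A[of "C x"]] by simp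
    qed
    then show "Domain A \<subseteq> {z. (inner (C z) u)\<^sup>2 \<le> c * (norm (D z))\<^sup>2}"
      using Domain_A by blast
  qed
  then have le: "(inner (C z) u)\<^sup>2 \<le> c * (norm (D z))\<^sup>2" for z
    using self_adjointD(3)[OF A] by (auto simp: densely_defined_def)
  have "linear (\<lambda>z. (D z, inner (C z) u))"
    by (rule linearI) (auto simp: inner_add_left)
  then have "subspace (range (\<lambda>z. (D z, inner (C z) u)))"
    by (rule linear_subspace_image) (rule subspace_UNIV)
  then obtain g where g: "\<forall>w r. (w, r) \<in> range (\<lambda>z. (D z, inner (C z) u)) \<longrightarrow> inner w g = r"
    by (rule Riesz_representation_graph[of _ c]) (use le in auto)
  then have "inner (D z) g = inner (C z) u" for z by auto
  then have "inner z (D g) = inner z (C u)" for z by (simp add: C_sym D_sym)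
  then have "D g = C u" by (metis inner_commute vector_eq_ldot)
  then show "u \<in> Range R" by (auto simp: R_def)
qed

end

text \<open>B = inverse (1 + A) is everywhere defined because 1 + A has lower bound 1. Nonnegativity
  of A makes both B and 1 - B contractions, as \<open>positive_sqrt\<close> requires for the two
  roots.\<close>

lemma sqrt_factors_exist:
  assumes J: "cplx \<longrightarrow> orth_complex_structure J"
    and A: "self_adjoint cplx J (A :: ('a::{real_inner, complete_space} \<times> 'a) set)"
    and nonneg: "nonneg_op A"
  obtains C D where "sqrt_factors cplx J A C D"
proof -
  note A' = self_adjointD[OF A]
  have "Range (shift_op A (-1)) = UNIV"
  proof (rule self_adjoint_Range[OF self_adjoint_shift_op[OF J A]])
    show "1 * (norm f)\<^sup>2 \<le> inner f y" if "(f, y) \<in> shift_op A (-1)" for f y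
      using that nonneg_opD[OF nonneg, of f "y - f"]
      by (simp add: mem_shift_op inner_diff_right power2_norm_eq_inner)
  qed simp
  then have "\<exists>f. (f, x - f) \<in> A" for x
    using mem_shift_op[of _ x A "-1"] by (auto simp: Range_iff)
  then obtain B where B: "\<And>x. (B x, x - B x) \<in> A" by metis
  have uniq: "f = g" if "(f, x - f) \<in> A" "(g, x - g) \<in> A" for f g x
  proof -
    have "(f - g, - (f - g)) \<in> A" using subspace_diff[OF A'(1) that] by simp
    from nonneg_opD[OF nonneg this] have "inner (f - g) (f - g) = 0"
      using inner_ge_zero[of "f - g"] by (simp only: inner_minus_right)
    then show ?thesis by simp
  qed
  have B_eq: "B (f + y) = f" if "(f, y) \<in> A" for f y
    using uniq[OF B[of "f + y"], of f] that by simp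
  have B_add: "B (x + y) = B x + B y" for x y
    using B_eq[of "B x + B y" "x - B x + (y - B y)"] subspace_add[OF A'(1) B[of x] B[of y]]
    by (simp add: algebra_simps)
  have B_scale: "B (c *\<^sub>R x) = c *\<^sub>R B x" for c x
    using B_eq[of "c *\<^sub>R B x" "c *\<^sub>R (x - B x)"] subspace_scale[OF A'(1) B[of x], of c]
    by (simp add: algebra_simps)
  have linB: "linear B" using B_add B_scale by (intro linearI)
  have pyth: "(norm (B x))\<^sup>2 + (norm (x - B x))\<^sup>2 \<le> (norm x)\<^sup>2" for x
    using nonneg_opD[OF nonneg B[of x]]
    by (simp add: power2_norm_eq_inner inner_diff_left inner_diff_right inner_commute)
  have B_le: "norm (B x) \<le> norm x" "norm (x - B x) \<le> norm x" for x
    using pyth[of x] by (smt (verit) norm_ge_zero power2_le_imp_le zero_le_power2)+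
  have blB: "bounded_linear B"
    using B_add B_scale B_le(1) by (intro bounded_linear_intro[of _ 1]) auto
  have B_sym: "inner (B x) y = inner x (B y)" for x y
    using symmetric_opD[OF A'(2) B[of x] B[of y]]
    by (simp add: inner_diff_left inner_diff_right)
  obtain C where C: "bounded_linear C" "\<And>x. norm (x - C x) \<le> norm x"
    "\<And>x y. inner (C x) y = inner x (C y)" "\<And>x. C (C x) = B x"
    "\<forall>X. bounded_linear X \<longrightarrow> (\<forall>x. X (B x) = B (X x)) \<longrightarrow> (\<forall>x. X (C x) = C (X x))"
    by (rule positive_sqrt[OF linB B_le(2) B_sym], rule that)
  have lin1B: "linear (\<lambda>x. x - B x)" using linB by (intro linear_compose_sub linear_ident)
  have 1: "norm (x - (x - B x)) \<le> norm x" for x using B_le(1) by simp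
  have 2: "inner (x - B x) y = inner x (y - B y)" for x y
    by (simp add: inner_diff_left inner_diff_right B_sym)
  obtain D where D: "bounded_linear D" "\<And>x. norm (x - D x) \<le> norm x"
    "\<And>x y. inner (D x) y = inner x (D y)" "\<And>x. D (D x) = x - B x"
    "\<forall>X. bounded_linear X \<longrightarrow> (\<forall>x. X (x - B x) = X x - B (X x)) \<longrightarrow> (\<forall>x. X (D x) = D (X x))"
    by (rule positive_sqrt[OF lin1B 1 2], rule that)
  have comm: "X (C x) = C (X x) \<and> X (D x) = D (X x)"
    if X: "bounded_linear X" "\<And>x. X (B x) = B (X x)" for X x
    using C(5) D(5) X linear_diff[OF bounded_linear.linear[OF X(1)]] by simp
  have "B (D x) = D (B x)" for x using comm[OF blB] by simp
  then have CD: "C (D x) = D (C x)" for x using comm[OF D(1)] by simp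
  \<comment> \<open>F is a root of C that commutes with D, so <C x, D x> = <F x, D (F x)>, which is
    nonnegative.\<close>
  obtain F where F: "bounded_linear F" "\<And>x. norm (x - F x) \<le> norm x"
    "\<And>x y. inner (F x) y = inner x (F y)" "\<And>x. F (F x) = C x"
    "\<forall>X. bounded_linear X \<longrightarrow> (\<forall>x. X (C x) = C (X x)) \<longrightarrow> (\<forall>x. X (F x) = F (X x))"
    by (rule positive_sqrt[OF bounded_linear.linear[OF C(1)] C(2,3)], rule that)
  have DF: "D (F x) = F (D x)" for x using F(5) D(1) CD by simp
  have D_nonneg: "0 \<le> inner x (D x)" for x
  proof -
    have "inner x (x - D x) \<le> norm x * norm x"
      using norm_cauchy_schwarz[of x "x - D x"] mult_left_mono[OF D(2)[of x] norm_ge_zero[of x]]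
      by linarith
    then show ?thesis by (simp add: inner_diff_right norm_eq_sqrt_inner)
  qed
  have "0 \<le> inner (C x) (D x)" for x
    using D_nonneg[of "F x"] by (simp add: DF F(3) flip: F(4))
  then have "sqrt_factors cplx J A C D"
    using J A nonneg C(1,3) D(1,3) CD comm B B_eq
    by (intro sqrt_factors.intro) (simp_all add: C(4) D(4))
  then show thesis by (rule that)
qed

lemma Range_op_sqrt_iff:
  assumes "cplx \<longrightarrow> orth_complex_structure J"
    and "self_adjoint cplx J (A :: ('a::{real_inner, complete_space} \<times> 'a) set)"
    and "nonneg_op A"
  shows "u \<in> Range (op_sqrt cplx J A) \<longleftrightarrow> (\<exists>c. \<forall>(f, y)\<in>A. (inner f u)\<^sup>2 \<le> c * inner f y)"
proof -
  obtain C D where "sqrt_factors cplx J A C D"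
    using sqrt_factors_exist[OF assms] .
  then interpret sqrt_factors cplx J A C D .
  show ?thesis using Range_R_iff by (simp add: op_sqrt_eq)
qed

section \<open>Extensions with the same lower bound\<close>

lemma lower_bound_ge_iff:
  "ereal c \<le> lower_bound G \<longleftrightarrow> (\<forall>(f, y)\<in>G. c * (norm f)\<^sup>2 \<le> inner f y)"
proof -
  have "ereal c \<le> ereal (inner f y / (norm f)\<^sup>2) \<longleftrightarrow> c * (norm f)\<^sup>2 \<le> inner f y"
    if "f \<noteq> 0" for f y :: 'a
    using that by (simp add: pos_le_divide_eq)
  then show ?thesis by (fastforce simp: lower_bound_def le_INF_iff)
qed

lemma lower_bound_antimono: "S \<subseteq> T \<Longrightarrow> lower_bound T \<le> lower_bound S"
  unfolding lower_bound_def by (rule INF_superset_mono) auto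

text \<open>An infinite lower bound is an infimum over no vectors at all; with a dense domain the
  whole space is then zero.\<close>

lemma lower_bound_eq_top:
  assumes "lower_bound G = \<infinity>" "(f, y) \<in> G"
  shows "f = 0"
proof (rule ccontr)
  assume "f \<noteq> 0"
  then have "lower_bound G \<le> ereal (inner f y / (norm f)\<^sup>2)"
    unfolding lower_bound_def using assms(2) by (intro INF_lower2[of "(f, y)"]) auto
  then show False using assms(1) by simp
qed

lemma nonneg_self_adjoint_Cauchy_Schwarz:
  assumes "self_adjoint cplx J A" "nonneg_op A" "(g, x) \<in> A" "(h, w) \<in> A"
  shows "(inner h x)\<^sup>2 \<le> inner h w * inner g x"
proof -
  have "(op_form (h, w) (g, x))\<^sup>2 \<le> op_form (h, w) (h, w) * op_form (g, x) (g, x)"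
  proof (rule bilinear_Cauchy_Schwarz[OF self_adjointD(1)[OF assms(1)] bilinear_op_form])
    show "op_form p q = op_form q p" if "p \<in> A" "q \<in> A" for p q
      using symmetric_opD[OF self_adjointD(2)[OF assms(1)], of "fst p" "snd p" "fst q" "snd q"] that
      by (simp add: op_form_def inner_commute)
    show "0 \<le> op_form p p" if "p \<in> A" for p
      using nonneg_opD[OF assms(2), of "fst p" "snd p"] that by (simp add: op_form_def)
  qed (use assms in auto)
  then show ?thesis by (simp add: op_form_def)
qed

context positive_symmetric
begin

lemma SF_square_le:
  assumes fy: "(f, y) \<in> SF"
    and c: "\<And>f y. (f, y) \<in> S \<Longrightarrow> (inner f u)\<^sup>2 \<le> c * (inner f y - \<mu> * (norm f)\<^sup>2)"
  shows "(inner f u)\<^sup>2 \<le> c * (inner f y - \<mu> * (norm f)\<^sup>2)"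
proof -
  obtain p where p: "form_approx S p f" using SF_D fy by meson
  then have lim: "(\<lambda>n. fst (p n)) \<longlonglongrightarrow> f" and pS: "p n \<in> S" for n by (auto simp: form_approx_def)
  have l1: "(\<lambda>n. (inner (fst (p n)) u)\<^sup>2) \<longlonglongrightarrow> (inner f u)\<^sup>2"
    using lim by (intro tendsto_intros)
  have l2: "(\<lambda>n. c * (op_form (p n) (p n) - \<mu> * (norm (fst (p n)))\<^sup>2))
      \<longlonglongrightarrow> c * (inner f y - \<mu> * (norm f)\<^sup>2)"
    using form_approx_limit[OF p p SF_D(1)[OF fy]] unfolding inner_commute[of y f]
    by (intro tendsto_intros lim)
  have "(inner (fst (p n)) u)\<^sup>2 \<le> c * (op_form (p n) (p n) - \<mu> * (norm (fst (p n)))\<^sup>2)" for n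
    using c[of "fst (p n)" "snd (p n)"] pS[of n] by (simp add: op_form_def)
  then show ?thesis by (intro LIMSEQ_le[OF l1 l2]) blast
qed

lemma shift_op_ge_nonneg:
  assumes "\<And>f y. (f, y) \<in> T \<Longrightarrow> \<mu> * (norm f)\<^sup>2 \<le> inner f y"
  shows "nonneg_op (shift_op T \<mu>)"
  using assms by (fastforce simp: nonneg_op_def shift_op_def inner_diff_right power2_norm_eq_inner)

lemma nonneg_shift_SF: "nonneg_op (shift_op SF \<mu>)"
  by (rule shift_op_ge_nonneg) (use SF_ge bound in blast)

text \<open>Turns the range condition into a quadratic inequality on S, so that the square root
  disappears from both directions.\<close>

lemma Range_sqrt_SF_iff:
  "u \<in> Range (op_sqrt cplx J (shift_op SF \<mu>)) \<longleftrightarrow>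
    (\<exists>c. \<forall>(f, y)\<in>S. (inner f u)\<^sup>2 \<le> c * (inner f y - \<mu> * (norm f)\<^sup>2))"
proof -
  have "(\<forall>(f, z)\<in>shift_op SF \<mu>. (inner f u)\<^sup>2 \<le> c * inner f z) \<longleftrightarrow>
      (\<forall>(f, y)\<in>S. (inner f u)\<^sup>2 \<le> c * (inner f y - \<mu> * (norm f)\<^sup>2))" (is "?L \<longleftrightarrow> ?R") for c
  proof -
    have "?L \<longleftrightarrow> (\<forall>(f, y)\<in>SF. (inner f u)\<^sup>2 \<le> c * inner f (y - \<mu> *\<^sub>R f))"
      unfolding shift_op_def by blast
    also have "\<dots> \<longleftrightarrow> (\<forall>(f, y)\<in>SF. (inner f u)\<^sup>2 \<le> c * (inner f y - \<mu> * (norm f)\<^sup>2))"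
      by (simp add: inner_diff_right power2_norm_eq_inner)
    also have "\<dots> \<longleftrightarrow> ?R"
      using SF_square_le[of _ _ u c] S_le_SF by blast
    finally show ?thesis .
  qed
  then show ?thesis
    using Range_op_sqrt_iff[OF J self_adjoint_shift_op[OF J self_adjoint_SF] nonneg_shift_SF]
    by simp
qed

section \<open>The two directions of the equivalence\<close>

lemma other_extension_imp_Range:
  assumes T: "self_adjoint cplx J T" "S \<subseteq> T" "T \<noteq> SF"
    and T_ge: "\<And>f y. (f, y) \<in> T \<Longrightarrow> \<mu> * (norm f)\<^sup>2 \<le> inner f y"
  shows "\<exists>u. u \<noteq> 0 \<and> (u, 0) \<in> adjoint_op S \<and> u \<in> Range (op_sqrt cplx J (shift_op SF \<mu>))"
proof -
  have "\<not> SF \<subseteq> T" using self_adjoint_maximal[OF self_adjoint_SF T(1)] T(3) by blast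
  then obtain f x where fx: "(f, x) \<in> SF" "(f, x) \<notin> T" by auto
  obtain g where gx: "(g, x) \<in> T"
    using self_adjoint_Range[OF T(1) \<mu> T_ge] by blast
  define u where "u = g - f"
  have "u \<noteq> 0" using fx gx by (auto simp: u_def)
  moreover have "(g, x) \<in> adjoint_op S"
    using gx adjoint_op_antimono[OF T(2)] self_adjointD(4)[OF T(1)] by auto
  then have "(u, 0) \<in> adjoint_op S"
    using subspace_diff[OF subspace_adjoint_op _ SF_D(1)[OF fx(1)], of "(g, x)"] by (simp add: u_def)
  moreover have "u \<in> Range (op_sqrt cplx J (shift_op SF \<mu>))"
  proof -
    \<comment> \<open>The form values of T - \<mu> at g and of \<open>SF\<close> - \<mu> at f, which
      do not depend on h. The factor 2 in the bound comes from (a - b)^2 \<le> 2 a^2 + 2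
      b^2.\<close>
    define c where "c = inner g (x - \<mu> *\<^sub>R g) + inner f (x - \<mu> *\<^sub>R f)"
    have in_shift: "(h, w) \<in> G \<Longrightarrow> (h, w - \<mu> *\<^sub>R h) \<in> shift_op G \<mu>" for h w and G :: "('a \<times> 'a) set"
      by (simp add: mem_shift_op)
    have "(inner h u)\<^sup>2 \<le> 2 * c / \<mu>\<^sup>2 * (inner h w - \<mu> * (norm h)\<^sup>2)" if hw: "(h, w) \<in> S" for h w
    proof -
      define q where "q = inner h (w - \<mu> *\<^sub>R h)"
      have 1: "(inner h (x - \<mu> *\<^sub>R g))\<^sup>2 \<le> q * inner g (x - \<mu> *\<^sub>R g)"
        unfolding q_def
        by (rule nonneg_self_adjoint_Cauchy_Schwarz[OF self_adjoint_shift_op[OF J T(1)]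
              shift_op_ge_nonneg[OF T_ge]])
          (use hw gx T(2) in \<open>auto intro!: in_shift\<close>)
      have 2: "(inner h (x - \<mu> *\<^sub>R f))\<^sup>2 \<le> q * inner f (x - \<mu> *\<^sub>R f)"
        unfolding q_def
        by (rule nonneg_self_adjoint_Cauchy_Schwarz[OF self_adjoint_shift_op[OF J self_adjoint_SF]
              nonneg_shift_SF])
          (use hw fx S_le_SF in \<open>auto intro!: in_shift\<close>)
      have "(\<mu> * inner h u)\<^sup>2 = (inner h (x - \<mu> *\<^sub>R f) - inner h (x - \<mu> *\<^sub>R g))\<^sup>2"
        by (simp add: u_def inner_diff_right algebra_simps)
      also have "\<dots> \<le> 2 * (inner h (x - \<mu> *\<^sub>R f))\<^sup>2 + 2 * (inner h (x - \<mu> *\<^sub>R g))\<^sup>2"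
        using zero_le_power2[of "inner h (x - \<mu> *\<^sub>R f) + inner h (x - \<mu> *\<^sub>R g)"]
        by (simp add: power2_sum power2_diff)
      also have "\<dots> \<le> 2 * c * q"
        using 1 2 by (simp add: c_def algebra_simps)
      finally have "(inner h u)\<^sup>2 \<le> 2 * c * q / \<mu>\<^sup>2"
        using \<mu> by (simp add: pos_le_divide_eq power_mult_distrib mult.commute)
      then show ?thesis by (simp add: q_def inner_diff_right power2_norm_eq_inner)
    qed
    then show ?thesis unfolding Range_sqrt_SF_iff by blast
  qed
  ultimately show ?thesis by blast
qed

lemma Range_imp_other_extension:
  assumes "u \<noteq> 0" and u: "(u, 0) \<in> adjoint_op S"
    and Ru: "u \<in> Range (op_sqrt cplx J (shift_op SF \<mu>))"
  shows "\<exists>T. self_adjoint cplx J T \<and> S \<subseteq> T \<and> T \<noteq> SF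
    \<and> (\<forall>(f, y)\<in>T. \<mu> * (norm f)\<^sup>2 \<le> inner f y)"
proof -
  define q where "q f y = inner f y - \<mu> * (norm f)\<^sup>2" for f y :: 'a
  have q_nonneg: "0 \<le> q f y" if "(f, y) \<in> S" for f y
    using bound[OF that] by (simp add: q_def)
  obtain c' where c': "\<And>f y. (f, y) \<in> S \<Longrightarrow> (inner f u)\<^sup>2 \<le> c' * q f y"
    using Ru unfolding Range_sqrt_SF_iff q_def by blast
  \<comment> \<open>The constant may grow since q is nonnegative on S; strict positivity allows the
    factor k to be cancelled at the end.\<close>
  define c where "c = \<bar>c'\<bar> + 1"
  have "c > 0" by (simp add: c_def)
  have "c' \<le> c" by (simp add: c_def)
  have c_S: "(inner f u)\<^sup>2 \<le> c * q f y" if "(f, y) \<in> S" for f y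
    using c'[OF that] mult_right_mono[OF \<open>c' \<le> c\<close> q_nonneg[OF that]] by (rule order_trans)
  have linJ: "linear J" if cplx using J that orth_complex_structureD(1) by blast
  note cJ = orth_complex_structureD(2-5)[OF mp[OF J]]
  \<comment> \<open>The perturbation has to commute with J, so in the complex case it lives on the
    real span of u and J u. Setting v = 0 lets the same formulas serve the real case.\<close>
  define v where "v = (if cplx then J u else 0)"
  have v: "(v, 0) \<in> adjoint_op S"
  proof (cases cplx)
    case True
    then have "(J u, J 0) \<in> adjoint_op S"
      using admissible_adjoint_op[OF J adm] u by (auto simp: admissible_def)
    then show ?thesis using True linear_0[OF linJ] by (simp add: v_def)
  next
    case False
    then show ?thesis by (simp add: v_def adjoint_op_def)
  qed
  have uv: "inner u v = 0" "norm v \<le> norm u"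
    using cJ(3)[of u u] cJ(4)[of u] by (auto simp: v_def inner_commute)
  have v_S: "(inner f v)\<^sup>2 \<le> c * q f y" if fy: "(f, y) \<in> S" for f y
  proof (cases cplx)
    case True
    have "(J f, J y) \<in> S" using adm True fy by (auto simp: admissible_def)
    from c_S[OF this] show ?thesis
      using True cJ(3)[OF True, of f u] by (simp add: v_def q_def cJ(2,4)[OF True])
  qed (use \<open>c > 0\<close> q_nonneg[OF fy] in \<open>simp add: v_def\<close>)
  \<comment> \<open>The bounds on <f, u>^2 and <f, v>^2 will be added.\<close>
  define k where "k = 2 * c"
  \<comment> \<open>With a = <x, u> and t = <f, u>, this value makes t^2 - 2 k \<mu> \<alpha> a t +
    (k \<alpha> - k \<mu> \<alpha>^2 |u|^2) a^2 a perfect square: the last coefficient becomes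
    \<open>(k * \<mu> * \<alpha>)^2\<close>.\<close>
  define \<alpha> where "\<alpha> = 1 / (k * \<mu>\<^sup>2 + \<mu> * (norm u)\<^sup>2)"
  have "k > 0" using \<open>c > 0\<close> by (simp add: k_def)
  have den: "k * \<mu>\<^sup>2 + \<mu> * (norm u)\<^sup>2 > 0"
    using \<open>k > 0\<close> \<mu> by (intro add_pos_nonneg) auto
  then have "\<alpha> > 0" and \<alpha>: "\<alpha> * (k * \<mu>\<^sup>2 + \<mu> * (norm u)\<^sup>2) = 1" by (simp_all add: \<alpha>_def)
  \<comment> \<open>Up to the factor |u|^2, the projection onto the span of u over the scalar
    field.\<close>
  define P where "P x = inner x u *\<^sub>R u + inner x v *\<^sub>R v" for x
  \<comment> \<open>L adds \<alpha> P to the inverse operator and keeps the second component, so the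
    range of T is still the whole space.\<close>
  define L where "L p = (fst p + \<alpha> *\<^sub>R P (snd p), snd p)" for p
  define T where "T = L ` SF"
  have T_iff: "(g, x) \<in> T \<longleftrightarrow> (\<exists>f. (f, x) \<in> SF \<and> g = f + \<alpha> *\<^sub>R P x)" for g x
    by (force simp: T_def L_def)
  have P_sym: "inner (P x) y = inner x (P y)" for x y
    by (simp add: P_def inner_add_left inner_add_right inner_commute mult.commute)
  have "linear L"
    by (rule linearI) (auto simp: L_def P_def inner_add_left algebra_simps)
  then have "subspace T"
    unfolding T_def using self_adjointD(1)[OF self_adjoint_SF] by (rule linear_subspace_image)
  moreover have "(J g, J x) \<in> T" if cplx "(g, x) \<in> T" for g x
  proof -
    obtain f where f: "(f, x) \<in> SF" "g = f + \<alpha> *\<^sub>R P x" using \<open>(g, x) \<in> T\<close> T_iff by blast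
    have "J (P x) = P (J x)"
      using linJ[OF \<open>cplx\<close>] \<open>cplx\<close> cJ(1)[OF \<open>cplx\<close>, of u] cJ(2,3)[OF \<open>cplx\<close>, of x u]
      by (simp add: P_def v_def linear_add linear_diff linear_cmul)
    moreover have "(J f, J x) \<in> SF"
      using f(1) admissible_SF \<open>cplx\<close> by (auto simp: admissible_def)
    ultimately show ?thesis
      using f(2) linJ[OF \<open>cplx\<close>] by (auto simp: T_iff linear_add linear_cmul)
  qed
  ultimately have "admissible cplx J T" by (auto simp: admissible_def)
  moreover have S_le_T: "S \<subseteq> T"
  proof (rule subrelI)
    fix f y assume fy: "(f, y) \<in> S"
    \<comment> \<open>The range of S is orthogonal to the kernel of its adjoint, so the perturbation
      does not touch S.\<close>
    then have "P y = 0"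
      using adjoint_opD[OF u fy] adjoint_opD[OF v fy] by (simp add: P_def)
    then show "(f, y) \<in> T" using S_le_SF fy by (auto simp: T_iff)
  qed
  moreover have "symmetric_op T"
  proof -
    have "inner f z = inner y g" if "(f, y) \<in> T" "(g, z) \<in> T" for f y g z
    proof -
      obtain f' g' where "(f', y) \<in> SF" "f = f' + \<alpha> *\<^sub>R P y" "(g', z) \<in> SF" "g = g' + \<alpha> *\<^sub>R P z"
        using \<open>(f, y) \<in> T\<close> \<open>(g, z) \<in> T\<close> unfolding T_iff by blast
      then show ?thesis
        using symmetric_opD[OF symmetric_SF, of f' y g' z]
        by (simp add: inner_add_left inner_add_right P_sym)
    qed
    then show ?thesis by (auto simp: symmetric_op_def)
  qed
  moreover have "Range T = UNIV"
  proof -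
    have "x \<in> Range T" for x
      using Range_SF T_iff by (metis RangeE RangeI UNIV_I)
    then show ?thesis by blast
  qed
  ultimately have "self_adjoint cplx J T"
    by (intro self_adjointI_Range densely_defined_extension)
  moreover have "T \<noteq> SF"
  proof
    assume "T = SF"
    obtain f where f: "(f, u) \<in> SF" using Range_SF by blast
    then have "(f + \<alpha> *\<^sub>R P u, u) \<in> SF" using T_iff \<open>T = SF\<close> by blast
    from subspace_diff[OF self_adjointD(1)[OF self_adjoint_SF] this f]
    have "(\<alpha> *\<^sub>R P u, 0) \<in> SF" by simp
    from SF_ge[OF this bound] have "\<alpha> *\<^sub>R P u = 0" using \<mu> by (simp add: mult_le_0_iff)
    then show False
      using \<open>\<alpha> > 0\<close> \<open>u \<noteq> 0\<close> uv(1) by (simp add: P_def)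
  qed
  moreover have "\<mu> * (norm g)\<^sup>2 \<le> inner g x" if gx: "(g, x) \<in> T" for g x
  proof -
    obtain f where f: "(f, x) \<in> SF" "g = f + \<alpha> *\<^sub>R P x" using gx T_iff by blast
    define a b t r where "a = inner x u" and "b = inner x v" and "t = inner f u" and "r = inner f v"
    have "t\<^sup>2 \<le> c * q f x" "r\<^sup>2 \<le> c * q f x"
      unfolding t_def r_def q_def
      using SF_square_le[OF f(1)] c_S v_S unfolding q_def by blast+
    then have le: "t\<^sup>2 + r\<^sup>2 \<le> k * q f x" by (simp add: k_def)
    have "inner g x = inner f x + \<alpha> * (a\<^sup>2 + b\<^sup>2)"
      using inner_commute[of u x] inner_commute[of v x]
      by (simp add: f(2) P_def a_def b_def inner_add_left power2_eq_square)
    moreover have "(norm g)\<^sup>2 = (norm f)\<^sup>2 + 2 * \<alpha> * (a * t + b * r)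
        + \<alpha>\<^sup>2 * (a\<^sup>2 * (norm u)\<^sup>2 + b\<^sup>2 * (norm v)\<^sup>2)"
    proof -
      have "inner v u = 0" using uv(1) by (simp add: inner_commute)
      then show ?thesis
        using uv(1) inner_commute[of u f] inner_commute[of v f]
        unfolding f(2) P_def a_def[symmetric] b_def[symmetric] power2_norm_eq_inner
        by (simp add: inner_add_left inner_add_right t_def r_def power2_eq_square algebra_simps)
    qed
    \<comment> \<open>The factor \<open>1\<close> is kept so that the equation for \<alpha> can
      replace it. The squares in t and r are then complete, and the surplus in b is nonnegative
      because |v| \<le> |u|.\<close>
    ultimately have "k * (inner g x - \<mu> * (norm g)\<^sup>2) = k * q f x
        + k * (\<alpha> * 1) * (a\<^sup>2 + b\<^sup>2) - 2 * k * \<mu> * \<alpha> * (a * t + b * r)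
        - k * \<mu> * \<alpha>\<^sup>2 * (a\<^sup>2 * (norm u)\<^sup>2 + b\<^sup>2 * (norm v)\<^sup>2)"
      by (simp add: q_def algebra_simps)
    also have "\<dots> = (k * q f x - t\<^sup>2 - r\<^sup>2)
        + (t - k * \<mu> * \<alpha> * a)\<^sup>2 + (r - k * \<mu> * \<alpha> * b)\<^sup>2
        + k * \<mu> * \<alpha>\<^sup>2 * b\<^sup>2 * ((norm u)\<^sup>2 - (norm v)\<^sup>2)"
      unfolding \<alpha>[symmetric] by (simp add: power2_eq_square algebra_simps)
    also have "\<dots> \<ge> 0"
      using le \<open>k > 0\<close> \<mu> uv(2) by (intro add_nonneg_nonneg mult_nonneg_nonneg) auto
    finally show ?thesis using \<open>k > 0\<close> by (simp add: zero_le_mult_iff)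
  qed
  ultimately show ?thesis using S_le_T by blast
qed

end

theorem theorem2p4:
  fixes S :: "('a::{real_inner, complete_space} \<times> 'a) set"
    and cplx :: bool and J :: "'a \<Rightarrow> 'a"
  assumes "cplx \<longrightarrow> orth_complex_structure J"
    and "lin_op cplx J S"
    and "densely_defined S"
    and "symmetric_op S"
    and "lower_bound S > 0"
  shows "(\<exists>T. self_adjoint cplx J T \<and> S \<subseteq> T \<and> T \<noteq> friedrichs cplx J S
              \<and> lower_bound T = lower_bound S)
     \<longleftrightarrow> Range (op_sqrt cplx J (shift_op (friedrichs cplx J S) (real_of_ereal (lower_bound S))))
           \<inter> ker_op (adjoint_op S) \<noteq> {0}"
proof (cases "lower_bound S")
  case (real m)
  have ge: "\<And>f y. (f, y) \<in> S \<Longrightarrow> m * (norm f)\<^sup>2 \<le> inner f y"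
    using lower_bound_ge_iff[of m S] real by auto
  interpret positive_symmetric cplx J S m
    using assms real ge by unfold_locales auto
  let ?X = "Range (op_sqrt cplx J (shift_op SF m))"
  \<comment> \<open>An extension cannot have a larger bound, so equality amounts to T \<ge>
    m.\<close>
  have "lower_bound T = lower_bound S \<longleftrightarrow> (\<forall>(f, y)\<in>T. m * (norm f)\<^sup>2 \<le> inner f y)"
    if "S \<subseteq> T" for T
    using lower_bound_antimono[OF that] lower_bound_ge_iff[of m T] real by auto
  then have "(\<exists>T. self_adjoint cplx J T \<and> S \<subseteq> T \<and> T \<noteq> SF \<and> lower_bound T = lower_bound S)
      \<longleftrightarrow> (\<exists>T. self_adjoint cplx J T \<and> S \<subseteq> T \<and> T \<noteq> SF
            \<and> (\<forall>(f, y)\<in>T. m * (norm f)\<^sup>2 \<le> inner f y))" by blast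
  also have "\<dots> \<longleftrightarrow> (\<exists>u. u \<noteq> 0 \<and> (u, 0) \<in> adjoint_op S \<and> u \<in> ?X)"
  proof (intro iffI; elim exE conjE)
    fix T assume "self_adjoint cplx J T" "S \<subseteq> T" "T \<noteq> SF"
      and "\<forall>(f, y)\<in>T. m * (norm f)\<^sup>2 \<le> inner f y"
    then show "\<exists>u. u \<noteq> 0 \<and> (u, 0) \<in> adjoint_op S \<and> u \<in> ?X"
      by (intro other_extension_imp_Range) auto
  qed (rule Range_imp_other_extension)
  also have "\<dots> \<longleftrightarrow> ?X \<inter> ker_op (adjoint_op S) \<noteq> {0}"
  proof -
    have "0 \<in> ?X" unfolding Range_sqrt_SF_iff by (rule exI[of _ 0]) auto
    moreover have "0 \<in> ker_op (adjoint_op S)"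
      using subspace_0[OF subspace_adjoint_op] by (simp add: ker_op_def zero_prod_def)
    ultimately show ?thesis by (auto simp: ker_op_def)
  qed
  finally show ?thesis by (simp add: real friedrichs_eq)
next
  case PInf
  \<comment> \<open>The space is zero here, every self-adjoint operator equals \<open>SF\<close>,
    and both sides are false. \<open>real_of_ereal\<close> sends infinity to 0, hence the shift by
    0.\<close>
  have S0: "f = 0" if "(f, y) \<in> S" for f y
    using lower_bound_eq_top[OF _ that] PInf by simp
  then have "closure (Domain S) \<subseteq> {0}" by (intro closure_minimal) auto
  then have triv: "x = 0" for x :: 'a using assms(3) by (auto simp: densely_defined_def)
  have ge: "1 * (norm f)\<^sup>2 \<le> inner f y" if "(f, y) \<in> S" for f y
    using S0[OF that] by simp
  interpret positive_symmetric cplx J S 1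
    using assms ge by unfold_locales auto
  have "inner f g = 0" for f g :: 'a using triv[of f] by simp
  then have "nonneg_op (shift_op SF 0)" by (simp add: nonneg_op_def)
  then have "0 \<in> Range (op_sqrt cplx J (shift_op SF 0))"
    by (intro iffD2[OF Range_op_sqrt_iff[OF J self_adjoint_shift_op[OF J self_adjoint_SF]]])
      (auto intro: exI[of _ 0])
  moreover have "0 \<in> ker_op (adjoint_op S)"
    using subspace_0[OF subspace_adjoint_op] by (simp add: ker_op_def zero_prod_def)
  ultimately have "Range (op_sqrt cplx J (shift_op SF 0)) \<inter> ker_op (adjoint_op S) = {0}"
    using triv by blast
  moreover have "T = SF" if "self_adjoint cplx J T" for T
  proof -
    have triv2: "p = 0" for p :: "'a \<times> 'a"
      using triv[of "fst p"] triv[of "snd p"] by (simp add: prod_eq_iff)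
    have "G = {0}" if "self_adjoint cplx J G" for G
      using subspace_0[OF self_adjointD(1)[OF that]] triv2 by blast
    then show ?thesis using that self_adjoint_SF by metis
  qed
  ultimately show ?thesis using PInf by (auto simp: friedrichs_eq)
next
  case MInf
  then show ?thesis using assms(5) by simp
qed

end
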